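(* For all integers $k\geq 5$ and $\ell\geq 3$, \[\mathrm{forb}(n,C^{(k)}_\ell)= 2^{(1+o(1)) \lfloor \frac{\ell-1}{2}\rfloor \binom{n}{k-1}}\quad\text{as } n\to\infty.\]
   Context: A $k$-graph is a pair $(V,E)$ where $E$ is a family of $k$-element subsets of $V$. For a $k$-graph $\mathcal{H}$, $\mathrm{forb}(n,\mathcal{H})$ is the number of labelled $k$-graphs on vertex set $[n]=\{1,\dots,n\}$ that contain no copy of $\mathcal{H}$ as a subgraph. The $k$-uniform linear cycle $C^{(k)}_\ell$ is the $k$-graph obtained from a graph cycle of length $\ell$ by enlarging each edge into a $k$-set by adding $k-2$ new vertices, each new vertex belonging only to that edge (distinct edges receive disjoint sets of new vertices). *)

theory Defs
  imports Complex_Main "HOL-Library.Landau_Symbols"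
begin

type_synonym 'a hypergraph = "'a set \<times> 'a set set"

abbreviation verts :: "'a hypergraph \<Rightarrow> 'a set" where
  "verts \<equiv> fst"

abbreviation edges :: "'a hypergraph \<Rightarrow> 'a set set" where
  "edges \<equiv> snd"

definition uniform_hypergraph :: "nat \<Rightarrow> 'a hypergraph \<Rightarrow> bool" where
  "uniform_hypergraph k H \<longleftrightarrow> (\<forall>e\<in>edges H. e \<subseteq> verts H \<and> finite e \<and> card e = k)"

text \<open>A copy of \<open>H\<close> in \<open>G\<close> is a subgraph of \<open>G\<close>, not necessarily induced, that is
  isomorphic to \<open>H\<close>.\<close>

definition contains_copy :: "'b hypergraph \<Rightarrow> 'a hypergraph \<Rightarrow> bool" where
  "contains_copy G H \<longleftrightarrow>
     (\<exists>f. inj_on f (verts H) \<and> f ` verts H \<subseteq> verts G \<and> (\<forall>e\<in>edges H. f ` e \<in> edges G))"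

text \<open>Labelled hypergraphs on a fixed vertex set are determined by their edge sets. The
  uniformity \<open>k\<close> is a separate argument because it cannot be read off a \<open>k\<close>-graph without edges.\<close>

definition forb :: "nat \<Rightarrow> nat \<Rightarrow> 'a hypergraph \<Rightarrow> nat" where
  "forb k n H =
     card {E. uniform_hypergraph k ({1..n}, E) \<and> \<not> contains_copy ({1..n}, E) H}"

text \<open>A cycle of length \<open>l\<close> only for \<open>l \<ge> 3\<close>: smaller \<open>l\<close> give a single edge or a singleton.\<close>

definition graph_cycle :: "nat \<Rightarrow> nat hypergraph" where
  "graph_cycle l = ({..<l}, {{i, Suc i mod l} | i. i < l})"

text \<open>The \<open>k - 2\<close> new vertices of the edge \<open>e\<close> are \<open>Inr (e, j)\<close> for \<open>j < k - 2\<close>; tagging them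
  with \<open>e\<close> makes the sets added to distinct edges disjoint.\<close>

definition enlarge_edge :: "nat \<Rightarrow> 'a set \<Rightarrow> ('a + 'a set \<times> nat) set" where
  "enlarge_edge k e = Inl ` e \<union> Inr ` ({e} \<times> {..<k - 2})"

definition enlargement :: "nat \<Rightarrow> 'a hypergraph \<Rightarrow> ('a + 'a set \<times> nat) hypergraph" where
  "enlargement k G =
     (Inl ` verts G \<union> Inr ` (edges G \<times> {..<k - 2}), enlarge_edge k ` edges G)"

definition linear_cycle :: "nat \<Rightarrow> nat \<Rightarrow> (nat + nat set \<times> nat) hypergraph" where
  "linear_cycle k l = enlargement k (graph_cycle l)"

lemma uniform_graph_cycle:
  assumes "l \<ge> 2"
  shows "uniform_hypergraph 2 (graph_cycle l)"
proof -
  have "i \<noteq> Suc i mod l" if "i < l" for i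
    using that assms by (cases "Suc i = l") auto
  then show ?thesis
    by (auto simp: uniform_hypergraph_def graph_cycle_def)
qed

lemma uniform_linear_cycle:
  assumes "k \<ge> 2" "l \<ge> 2"
  shows "uniform_hypergraph k (linear_cycle k l)"
proof -
  have "card (enlarge_edge k e) = k" if "finite e" "card e = 2" for e :: "nat set"
  proof -
    have "card (enlarge_edge k e) = card (Inl ` e :: (nat + nat set \<times> nat) set)
        + card (Inr ` ({e} \<times> {..<k - 2}) :: (nat + nat set \<times> nat) set)"
      unfolding enlarge_edge_def using that by (intro card_Un_disjoint) auto
    also have "\<dots> = 2 + (k - 2)"
      using that by (simp add: card_image card_cartesian_product)
    finally show ?thesis using assms by simp
  qed
  then show ?thesis
    using uniform_graph_cycle[OF assms(2)]
    by (auto simp: uniform_hypergraph_def linear_cycle_def enlargement_def enlarge_edge_def)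
qed

end

theory Submission
  imports Defs "HOL-Library.FuncSet" "HOL-Real_Asymp.Real_Asymp"
begin

text \<open>Write \<open>t = \<lfloor>(l - 1) / 2\<rfloor>\<close>. The lower bound counts the families of \<open>k\<close>-sets meeting a
  fixed \<open>t\<close>-set in one vertex: no \<open>t\<close> vertices cover all edges of the cycle.

  For the upper bound, call \<open>F\<close> centered in a cycle-free \<open>H\<close> if some \<open>x \<in> F\<close> is such that every
  \<open>{x, y, y'} \<subseteq> F\<close> is a robust kernel of \<open>H\<close>. By Fueredi's delta-system method, on the edges that
  are rainbow for a given \<open>k\<close>-colouring, \<open>H\<close> is the union of boundedly many families whose pairwise
  intersections have a fixed structure. As \<open>k \<ge> 5\<close>, each of them has at most \<open>n ^ (k - 2)\<close> edges,
  or yields a cycle, or consists of centered edges. Polylogarithmically many colourings make every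
  edge rainbow, so all but \<open>n ^ (k - 2) * polylog n\<close> edges of \<open>H\<close> are centered. The list of robust
  kernels costs only \<open>n ^ 3\<close> bits, and it determines a set of at most
  \<open>t * (n choose (k - 1)) + O(n ^ 2)\<close> possible centered edges: otherwise many \<open>(k - 1)\<close>-sets have
  more than \<open>t\<close> centres, and alternating between centres and the vertices of a path in the link of
  one centre closes up to a cycle.\<close>

section \<open>Robust kernels and linear cycles\<close>

text \<open>This plays the role of a kernel of a large sunflower; when it fails, the edges containing \<open>T\<close>
  have a cover outside \<open>T\<close> by at most \<open>m\<close> vertices.\<close>

definition robust_kernel :: "nat \<Rightarrow> 'a set set \<Rightarrow> 'a set \<Rightarrow> bool" where
  "robust_kernel m H T \<longleftrightarrow> (\<forall>X. finite X \<and> card X \<le> m \<longrightarrow> (\<exists>F\<in>H. T \<subseteq> F \<and> F \<inter> X \<subseteq> T))"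

lemma robust_kernelE:
  assumes "robust_kernel m H T" "finite X" "card X \<le> m"
  obtains F where "F \<in> H" "T \<subseteq> F" "F \<inter> X \<subseteq> T"
  using assms unfolding robust_kernel_def by blast

lemma not_robust_kernelE:
  assumes "\<not> robust_kernel m H T"
  obtains X where "finite X" "card X \<le> m" "\<And>F. F \<in> H \<Longrightarrow> T \<subseteq> F \<Longrightarrow> \<not> F \<inter> X \<subseteq> T"
  using assms unfolding robust_kernel_def by meson

lemma robust_kernel_mono: "robust_kernel m H T \<Longrightarrow> H \<subseteq> H' \<Longrightarrow> robust_kernel m H' T"
  unfolding robust_kernel_def by (meson subsetD)

text \<open>If two different indices gave the same edge, each would be the cyclic successor of the
  other, which forces \<open>l = 2\<close>.\<close>

lemma cycle_edge_inj:
  assumes "3 \<le> l"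
  shows "inj_on (\<lambda>i. {i, Suc i mod l}) {..<l}"
proof (rule inj_onI, rule ccontr)
  fix i j assume ij: "i \<in> {..<l}" "j \<in> {..<l}" "{i, Suc i mod l} = {j, Suc j mod l}" "i \<noteq> j"
  then have "i = Suc j mod l" "j = Suc i mod l"
    by (auto simp: doubleton_eq_iff)
  moreover have "Suc h mod l = (if Suc h = l then 0 else Suc h)" if "h < l" for h
    using that by auto
  ultimately show False
    using ij(1,2) assms by (simp split: if_splits)
qed

text \<open>The edges are chosen one after another, each avoiding, outside its own kernel, all
  kernels and all earlier edges. These have at most \<open>3 * l + k * l\<close> vertices together,
  whence the bound on \<open>m\<close>.\<close>

lemma greedy_edges:
  fixes A :: "nat \<Rightarrow> 'a set"
  assumes unif: "\<And>F. F \<in> H \<Longrightarrow> finite F \<and> card F = k"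
    and fin: "\<And>i. i < l \<Longrightarrow> finite (A i) \<and> card (A i) \<le> 3"
    and ker: "\<And>i. i < l \<Longrightarrow> robust_kernel m H (A i)"
    and m: "l * (k + 3) \<le> m"
    and "j \<le> l"
  shows "\<exists>E. \<forall>i<j. E i \<in> H \<and> A i \<subseteq> E i \<and> E i \<inter> (\<Union>h<l. A h) \<subseteq> A i \<and> (\<forall>h<i. E i \<inter> E h \<subseteq> A i)"
  using \<open>j \<le> l\<close>
proof (induction j)
  case 0
  show ?case by simp
next
  case (Suc j)
  then obtain E where E: "\<forall>i<j. E i \<in> H \<and> A i \<subseteq> E i \<and> E i \<inter> (\<Union>h<l. A h) \<subseteq> A i \<and>
      (\<forall>h<i. E i \<inter> E h \<subseteq> A i)"
    by auto
  define X where "X = (\<Union>h<l. A h) \<union> (\<Union>h<j. E h)"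
  have "card (\<Union>h<l. A h) \<le> (\<Sum>h<l. card (A h))"
    by (rule card_UN_le) simp
  also have "\<dots> \<le> (\<Sum>h<l. 3)"
    using fin by (intro sum_mono) simp
  finally have 1: "card (\<Union>h<l. A h) \<le> l * 3" by simp
  have "card (\<Union>h<j. E h) \<le> (\<Sum>h<j. card (E h))"
    by (rule card_UN_le) simp
  also have "\<dots> = (\<Sum>h<j. k)"
    using E unif by (intro sum.cong) auto
  also have "\<dots> \<le> l * k" using Suc.prems by simp
  finally have "card X \<le> m"
    using 1 card_Un_le[of "\<Union>h<l. A h" "\<Union>h<j. E h"] m unfolding X_def by (simp add: algebra_simps)
  moreover have "finite X"
    unfolding X_def using fin E unif by auto
  ultimately obtain F where F: "F \<in> H" "A j \<subseteq> F" "F \<inter> X \<subseteq> A j"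
    using robust_kernelE[OF ker[of j]] Suc.prems by (metis Suc_le_lessD)
  have "\<forall>i<Suc j. (E(j := F)) i \<in> H \<and> A i \<subseteq> (E(j := F)) i \<and>
      (E(j := F)) i \<inter> (\<Union>h<l. A h) \<subseteq> A i \<and> (\<forall>h<i. (E(j := F)) i \<inter> (E(j := F)) h \<subseteq> A i)"
    using E F unfolding X_def by (auto simp: less_Suc_eq)
  then show ?case by blast
qed

text \<open>It suffices to find a cycle of robust kernels: \<open>greedy_edges\<close> extends them
  to edges without new common vertices. A kernel may have a third vertex, which the odd case of
  \<open>alternating_cycle\<close> uses.\<close>

lemma contains_linear_cycle:
  fixes v :: "nat \<Rightarrow> 'a" and A :: "nat \<Rightarrow> 'a set"
  assumes l: "3 \<le> l" and k: "2 \<le> k"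
    and unif: "uniform_hypergraph k (V, H)"
    and inj: "inj_on v {..<l}"
    and fin: "\<And>i. i < l \<Longrightarrow> finite (A i) \<and> card (A i) \<le> 3"
    and vA: "\<And>i. i < l \<Longrightarrow> v i \<in> A i \<and> v (Suc i mod l) \<in> A i"
    and ker: "\<And>i. i < l \<Longrightarrow> robust_kernel m H (A i)"
    and disj: "\<And>i j. i < l \<Longrightarrow> j < l \<Longrightarrow> i \<noteq> j \<Longrightarrow> A i \<inter> A j \<subseteq> {v i, v (Suc i mod l)}"
    and m: "l * (k + 3) \<le> m"
  shows "contains_copy (V, H) (linear_cycle k l)"
proof -
  have H: "finite F \<and> card F = k \<and> F \<subseteq> V" if "F \<in> H" for F
    using unif that by (auto simp: uniform_hypergraph_def)
  obtain E where E: "\<And>i. i < l \<Longrightarrow> E i \<in> H \<and> A i \<subseteq> E i \<and> E i \<inter> (\<Union>h<l. A h) \<subseteq> A i"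
    and E': "\<And>i h. h < i \<Longrightarrow> i < l \<Longrightarrow> E i \<inter> E h \<subseteq> A i"
    using greedy_edges[of H k l A m l] H fin ker m by (metis order_refl)
  define e where "e i = {i, Suc i mod l}" for i
  have e_inj: "inj_on e {..<l}"
    using cycle_edge_inj[OF l] unfolding e_def .
  \<comment> \<open>\<open>W i\<close> will be the image of the new vertices of the
    \<open>i\<close>-th edge.\<close>
  define W where "W i = E i - {v i, v (Suc i mod l)}" for i
  have succ: "Suc i mod l < l" "Suc i mod l \<noteq> i" if "i < l" for i
    using that l by (cases "Suc i = l"; simp)+
  have cardW: "card (W i) = k - 2" "finite (W i)" if "i < l" for i
  proof -
    have "v i \<noteq> v (Suc i mod l)"
      using inj succ[OF that] that by (auto dest: inj_onD)
    moreover have "{v i, v (Suc i mod l)} \<subseteq> E i"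
      using vA E that by blast
    ultimately show "card (W i) = k - 2" "finite (W i)"
      using H E that unfolding W_def by (auto simp: card_Diff_subset)
  qed
  have "\<exists>g. bij_betw g {..<k - 2} (W i)" if "i < l" for i
    using cardW[OF that] ex_bij_betw_nat_finite[of "W i"] by (auto simp: atLeast0LessThan)
  then obtain g where g: "\<And>i. i < l \<Longrightarrow> bij_betw (g i) {..<k - 2} (W i)"
    by metis
  \<comment> \<open>The common part lies in the kernel of the later edge by the greedy choice, hence
    in the union of the kernels, which the earlier edge meets only in its own.\<close>
  have int: "E i \<inter> E j \<subseteq> A i \<inter> A j" if "i < l" "j < l" "i \<noteq> j" for i j
  proof -
    have *: "E i \<inter> E j \<subseteq> A i \<inter> A j" if "i < j" "j < l" for i j
      using E'[OF that] E[of i] that by force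
    show ?thesis
      using that *[of i j] *[of j i] by (cases "i < j") auto
  qed
  have W_disj: "W i \<inter> W j = {}" if "i < l" "j < l" "i \<noteq> j" for i j
    using int[OF that] disj[OF that] unfolding W_def by blast
  have vW: "v j \<notin> W i" if "i < l" "j < l" for i j
  proof
    assume "v j \<in> W i"
    then have "v j \<in> E i \<inter> E j" "v j \<notin> {v i, v (Suc i mod l)}"
      using vA[of j] E[of j] that unfolding W_def by auto
    moreover from this have "i \<noteq> j" by auto
    ultimately show False using int disj that by blast
  qed
  \<comment> \<open>New vertices are tagged by their edge as a set, so its position on the cycle has
    to be recovered from that set.\<close>
  define idx where "idx = inv_into {..<l} e"
  have idx: "idx (e i) = i" if "i < l" for i
    unfolding idx_def using e_inj that by (simp add: inv_into_f_f)
  define f where "f x = (case x of Inl i \<Rightarrow> v i | Inr (d, j) \<Rightarrow> g (idx d) j)" for x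
  have fl: "f (Inl i) = v i" for i by (simp add: f_def)
  have fr: "f (Inr (e i, j)) = g i j" if "i < l" for i j
    by (simp add: f_def idx that)
  have gW: "g i j \<in> W i" if "i < l" "j < k - 2" for i j
    using g[OF that(1)] that(2) by (auto simp: bij_betw_def)
  have ed: "edges (graph_cycle l) = e ` {..<l}"
    by (auto simp: graph_cycle_def e_def)
  have vs: "verts (linear_cycle k l) = Inl ` {..<l} \<union> Inr ` (e ` {..<l} \<times> {..<k - 2})"
    by (simp add: linear_cycle_def enlargement_def ed) (simp add: graph_cycle_def)
  have es: "edges (linear_cycle k l) = enlarge_edge k ` e ` {..<l}"
    by (simp add: linear_cycle_def enlargement_def ed)
  have "inj_on f (verts (linear_cycle k l))"
  proof -
    have ll: "x = y" if "x < l" "y < l" "v x = v y" for x y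
      using inj that by (auto dest: inj_onD)
    have rr: "i = i' \<and> j = j'" if "i < l" "i' < l" "j < k - 2" "j' < k - 2" "g i j = g i' j'" for i i' j j'
    proof -
      have "i = i'" using W_disj[of i i'] gW that by (metis disjoint_iff)
      then show ?thesis using g[of i] that by (auto simp: bij_betw_def dest: inj_onD)
    qed
    have lr: "v x \<noteq> g i j" if "x < l" "i < l" "j < k - 2" for x i j
      using vW gW that by metis
    show ?thesis
      unfolding vs inj_on_def
      by (auto simp: fl fr dest: ll rr) (metis lr | metis lr rr)+
  qed
  moreover have im: "f ` enlarge_edge k (e i) = E i" if "i < l" for i
  proof -
    have "f ` enlarge_edge k (e i) = v ` e i \<union> g i ` {..<k - 2}"
      unfolding enlarge_edge_def using that
      by (simp add: Sigma_def image_Un image_image fl fr UNION_singleton_eq_range)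
    also have "\<dots> = {v i, v (Suc i mod l)} \<union> W i"
      using g[OF that] by (auto simp: bij_betw_def e_def)
    also have "\<dots> = E i"
      using vA[OF that] E[OF that] unfolding W_def by auto
    finally show ?thesis .
  qed
  moreover have "f ` verts (linear_cycle k l) \<subseteq> V"
  proof -
    have "v i \<in> V" if "i < l" for i using vA E H that by blast
    moreover have "g i j \<in> V" if "i < l" "j < k - 2" for i j
      using gW[OF that] E H that unfolding W_def by blast
    ultimately show ?thesis unfolding vs by (auto simp: fl fr)
  qed
  ultimately show ?thesis
    unfolding contains_copy_def es using E by (intro exI[of _ f]) (auto simp: im)
qed

section \<open>Homogeneous decomposition\<close>

text \<open>If \<open>\<chi>\<close> is a bijection from \<open>F\<close> to the colours \<open>{..<k}\<close>, then \<open>F \<inter> \<chi> -` A\<close> is the part of \<open>F\<close>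
  with colours in \<open>A\<close>.\<close>

lemma image_vimage_rainbow:
  assumes "bij_betw \<chi> F {..<k}" "A \<subseteq> {..<k}"
  shows "\<chi> ` (F \<inter> \<chi> -` A) = A"
proof -
  have "\<chi> ` (F \<inter> \<chi> -` A) = \<chi> ` F \<inter> A" by auto
  then show ?thesis using assms by (auto simp: bij_betw_def)
qed

lemma vimage_image_rainbow:
  assumes "inj_on \<chi> F" "T \<subseteq> F"
  shows "F \<inter> \<chi> -` (\<chi> ` T) = T"
  using assms by (auto dest: inj_onD)

text \<open>\<open>None\<close> marks the edges that survive the removal. The other labels split the
  removed edges into at most \<open>card Q * m\<close> classes, each of which has lost one
  intersection type.\<close>

definition peeling :: "('a \<Rightarrow> nat) \<Rightarrow> nat \<Rightarrow> nat set set \<Rightarrow> 'a set set \<Rightarrow>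
    ('a set \<Rightarrow> (nat set \<times> nat) option) \<Rightarrow> bool" where
  "peeling \<chi> m Q H g \<longleftrightarrow> g ` H \<subseteq> insert None (Some ` (Q \<times> {..<m})) \<and>
     (\<forall>F\<in>H. g F = None \<longrightarrow> (\<forall>A\<in>Q. robust_kernel m {F\<in>H. g F = None} (F \<inter> \<chi> -` A))) \<and>
     (\<forall>F\<in>H. \<forall>F'\<in>H. \<forall>A i. g F = Some (A, i) \<longrightarrow> g F' = Some (A, i) \<longrightarrow> \<chi> ` (F \<inter> F') \<noteq> A)"

lemmas peelingD =
  iffD1[OF peeling_def, THEN conjunct1]
  iffD1[OF peeling_def, THEN conjunct2, THEN conjunct1]
  iffD1[OF peeling_def, THEN conjunct2, THEN conjunct2]

text \<open>Repeatedly remove all edges containing a part \<open>T = F \<inter> \<chi> -` A\<close> that is not a robust kernel, and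
  label each of them by \<open>A\<close> and a vertex outside \<open>T\<close> from a cover. Two edges with the same label that
  share \<open>T\<close> also share a further vertex, so \<open>A\<close> is not the colour set of an intersection.\<close>

lemma ex_peeling:
  fixes \<chi> :: "'a \<Rightarrow> nat"
  assumes "finite H" "\<forall>F\<in>H. bij_betw \<chi> F {..<k}" and Q: "Q \<subseteq> Pow {..<k}"
  shows "\<exists>g. peeling \<chi> m Q H g"
  using assms(1,2)
proof (induction "card H" arbitrary: H rule: less_induct)
  case less
  show ?case
  proof (cases "\<forall>F\<in>H. \<forall>A\<in>Q. robust_kernel m H (F \<inter> \<chi> -` A)")
    case True
    then have "peeling \<chi> m Q H (\<lambda>_. None)" unfolding peeling_def by auto
    then show ?thesis by blast
  next
    case False
    then obtain F0 A where F0: "F0 \<in> H" "A \<in> Q" "\<not> robust_kernel m H (F0 \<inter> \<chi> -` A)"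
      by blast
    from F0(3) obtain X where fX: "finite X" "card X \<le> m"
      and X: "\<And>F. F \<in> H \<Longrightarrow> F0 \<inter> \<chi> -` A \<subseteq> F \<Longrightarrow> \<not> F \<inter> X \<subseteq> F0 \<inter> \<chi> -` A"
      by (rule not_robust_kernelE) (rule that)
    define T where "T = F0 \<inter> \<chi> -` A"
    have chiT: "\<chi> ` T = A"
      unfolding T_def using image_vimage_rainbow[OF less.prems(2)[rule_format, OF F0(1)]] F0(2) Q by blast
    define H' where "H' = {F\<in>H. \<not> T \<subseteq> F}"
    have "H' \<subset> H" unfolding H'_def T_def using F0 by auto
    then have "card H' < card H" using less.prems(1) by (simp add: psubset_card_mono)
    moreover have "finite H'" "\<forall>F\<in>H'. bij_betw \<chi> F {..<k}"
      using less.prems unfolding H'_def by auto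
    ultimately obtain g where "peeling \<chi> m Q H' g"
      using less.hyps by blast
    note g = peelingD[OF this]
    obtain h where "bij_betw h X {0..<card X}"
      using ex_bij_betw_finite_nat[OF fX(1)] by blast
    then have h: "inj_on h X" "h ` X \<subseteq> {..<m}"
      using fX(2) by (auto simp: bij_betw_def)
    define x where "x F = (SOME x. x \<in> F \<inter> X \<and> x \<notin> T)" for F
    have x: "x F \<in> F \<inter> X \<and> x F \<notin> T" if "F \<in> H" "T \<subseteq> F" for F
    proof -
      have "\<exists>x. x \<in> F \<inter> X \<and> x \<notin> T" using X[OF that(1)] that(2) unfolding T_def[symmetric] by auto
      then show ?thesis unfolding x_def by (rule someI_ex)
    qed
    define g' where "g' F = (if T \<subseteq> F then Some (A, h (x F)) else g F)" for F
    have "g' ` H \<subseteq> insert None (Some ` (Q \<times> {..<m}))"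
    proof (rule image_subsetI)
      fix F assume F: "F \<in> H"
      show "g' F \<in> insert None (Some ` (Q \<times> {..<m}))"
      proof (cases "T \<subseteq> F")
        case True
        then show ?thesis using x[OF F True] h F0 unfolding g'_def by auto
      next
        case False
        then have "F \<in> H'" using F unfolding H'_def by auto
        then show ?thesis using g(1) False unfolding g'_def by auto
      qed
    qed
    moreover have "{F\<in>H. g' F = None} = {F\<in>H'. g F = None}"
      unfolding g'_def H'_def by auto
    then have "\<forall>F\<in>H. g' F = None \<longrightarrow> (\<forall>A\<in>Q. robust_kernel m {F\<in>H. g' F = None} (F \<inter> \<chi> -` A))"
      using g(2) by auto
    moreover have "\<chi> ` (F \<inter> F') \<noteq> B"
      if F: "F \<in> H" "F' \<in> H" and B: "g' F = Some (B, i)" "g' F' = Some (B, i)" for F F' B i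
    proof
      assume eq: "\<chi> ` (F \<inter> F') = B"
      have T: "T = F1 \<inter> \<chi> -` A" if "F1 \<in> H" "T \<subseteq> F1" for F1
        using vimage_image_rainbow[OF _ that(2), of \<chi>] less.prems(2)[rule_format, OF that(1)] chiT by (auto simp: bij_betw_def)
      \<comment> \<open>The recursive call may use the type \<open>A\<close> again, so a label can
        be shared although only one of the edges contains \<open>T\<close>. But inside that edge an
        intersection with colour set \<open>A\<close> would be \<open>T\<close> itself.\<close>
      have mix: False if "F1 \<in> H" "F2 \<in> H" "T \<subseteq> F1" "\<not> T \<subseteq> F2" "\<chi> ` (F1 \<inter> F2) = A" for F1 F2
      proof -
        have "F1 \<inter> F2 = F1 \<inter> \<chi> -` A"
          using vimage_image_rainbow[of \<chi> F1 "F1 \<inter> F2"] less.prems(2)[rule_format, OF that(1)] that(5)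
          by (auto simp: bij_betw_def)
        then have "T \<subseteq> F2" using T[OF that(1,3)] by auto
        then show False using that(4) by simp
      qed
      show False
      proof (cases "T \<subseteq> F"; cases "T \<subseteq> F'")
        assume TF: "T \<subseteq> F" "T \<subseteq> F'"
        then have "B = A" "h (x F) = h (x F')" using B unfolding g'_def by auto
        then have "x F = x F'" using x F TF h(1) by (metis IntD2 inj_onD)
        then have xx: "x F \<in> F \<inter> F'" "x F \<notin> T" using x F TF by (metis IntD1 IntI)+
        then have "\<chi> (x F) \<in> A" using eq \<open>B = A\<close> by auto
        then show False using T[OF F(1) TF(1)] xx by auto
      next
        assume TF: "T \<subseteq> F" "\<not> T \<subseteq> F'"
        then have "B = A" using B unfolding g'_def by auto
        then show False using mix[OF F TF] eq by auto
      next
        assume TF: "\<not> T \<subseteq> F" "T \<subseteq> F'"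
        then have "B = A" using B unfolding g'_def by auto
        then show False using mix[OF F(2,1) TF(2,1)] eq by (auto simp: Int_commute)
      next
        assume TF: "\<not> T \<subseteq> F" "\<not> T \<subseteq> F'"
        then show False using g(3) F B eq unfolding g'_def H'_def by auto
      qed
    qed
    ultimately have "peeling \<chi> m Q H g'" unfolding peeling_def by blast
    then show ?thesis by blast
  qed
qed

text \<open>These are the families with a fixed intersection structure from Fueredi's delta-system
  method; the colouring identifies corresponding vertices of different edges.\<close>

definition homogeneous :: "('a \<Rightarrow> nat) \<Rightarrow> nat \<Rightarrow> nat set set \<Rightarrow> 'a set set \<Rightarrow> bool" where
  "homogeneous \<chi> m Q P \<longleftrightarrow> (\<forall>F\<in>P. \<forall>A\<in>Q. robust_kernel m P (F \<inter> \<chi> -` A)) \<and>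
     (\<forall>F\<in>P. \<forall>F'\<in>P. F \<noteq> F' \<longrightarrow> \<chi> ` (F \<inter> F') \<in> Q)"

text \<open>Induction on the number of allowed types. Peeling leaves one family that is homogeneous
  for \<open>Q\<close> itself, and in each of the other classes some type \<open>A\<close> no longer
  occurs, so that \<open>Q - {A}\<close> takes the place of \<open>Q\<close>.\<close>

lemma homogeneous_decomposition:
  fixes k m q :: nat
  shows "\<exists>N. \<forall>(\<chi> :: 'a \<Rightarrow> nat) H Q. finite H \<longrightarrow> (\<forall>F\<in>H. bij_betw \<chi> F {..<k}) \<longrightarrow>
    Q \<subseteq> Pow {..<k} \<longrightarrow> card Q = q \<longrightarrow>
    (\<forall>F\<in>H. \<forall>F'\<in>H. F \<noteq> F' \<longrightarrow> \<chi> ` (F \<inter> F') \<in> Q) \<longrightarrow>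
    (\<exists>\<P>. finite \<P> \<and> card \<P> \<le> N \<and> \<Union>\<P> = H \<and> (\<forall>P\<in>\<P>. \<exists>Q'\<subseteq>Q. homogeneous \<chi> m Q' P))"
proof (induction q)
  case 0
  show ?case
  proof (intro exI[of _ 1] allI impI)
    fix \<chi> :: "'a \<Rightarrow> nat" and H Q
    assume *: "Q \<subseteq> Pow {..<k}" "card Q = 0" "\<forall>F\<in>H. \<forall>F'\<in>H. F \<noteq> F' \<longrightarrow> \<chi> ` (F \<inter> F') \<in> Q"
    then have "Q = {}" using finite_subset[of Q "Pow {..<k}"] by auto
    then show "\<exists>\<P>. finite \<P> \<and> card \<P> \<le> 1 \<and> \<Union>\<P> = H \<and> (\<forall>P\<in>\<P>. \<exists>Q'\<subseteq>Q. homogeneous \<chi> m Q' P)"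
      using * by (intro exI[of _ "{H}"]) (auto simp: homogeneous_def)
  qed
next
  case (Suc q)
  then obtain N where N: "\<And>(\<chi> :: 'a \<Rightarrow> nat) H Q. finite H \<Longrightarrow> \<forall>F\<in>H. bij_betw \<chi> F {..<k} \<Longrightarrow>
    Q \<subseteq> Pow {..<k} \<Longrightarrow> card Q = q \<Longrightarrow>
    \<forall>F\<in>H. \<forall>F'\<in>H. F \<noteq> F' \<longrightarrow> \<chi> ` (F \<inter> F') \<in> Q \<Longrightarrow>
    \<exists>\<P>. finite \<P> \<and> card \<P> \<le> N \<and> \<Union>\<P> = H \<and> (\<forall>P\<in>\<P>. \<exists>Q'\<subseteq>Q. homogeneous \<chi> m Q' P)"
    by auto
  show ?case
  proof (intro exI[of _ "1 + Suc q * m * N"] allI impI)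
    fix \<chi> :: "'a \<Rightarrow> nat" and H Q
    assume H: "finite H" "\<forall>F\<in>H. bij_betw \<chi> F {..<k}" and Q: "Q \<subseteq> Pow {..<k}" "card Q = Suc q"
      and int: "\<forall>F\<in>H. \<forall>F'\<in>H. F \<noteq> F' \<longrightarrow> \<chi> ` (F \<inter> F') \<in> Q"
    have finQ: "finite Q" using Q(2) by (simp add: card_ge_0_finite)
    obtain g where "peeling \<chi> m Q H g"
      using ex_peeling[OF H Q(1)] by blast
    note g = peelingD[OF this]
    define part where "part a = {F\<in>H. g F = Some a}" for a
    have "\<exists>\<P>. finite \<P> \<and> card \<P> \<le> N \<and> \<Union>\<P> = part a \<and> (\<forall>P\<in>\<P>. \<exists>Q'\<subseteq>Q. homogeneous \<chi> m Q' P)"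
      if a: "a \<in> Q \<times> {..<m}" for a
    proof -
      obtain A i where ai: "a = (A, i)" by (cases a)
      have "\<exists>\<P>. finite \<P> \<and> card \<P> \<le> N \<and> \<Union>\<P> = part a \<and>
          (\<forall>P\<in>\<P>. \<exists>Q'\<subseteq>Q - {A}. homogeneous \<chi> m Q' P)"
      proof (rule N)
        show "card (Q - {A}) = q" using a ai Q finQ by auto
        show "\<forall>F\<in>part a. \<forall>F'\<in>part a. F \<noteq> F' \<longrightarrow> \<chi> ` (F \<inter> F') \<in> Q - {A}"
        proof (intro ballI impI)
          fix F F' assume "F \<in> part a" "F' \<in> part a" "F \<noteq> F'"
          then show "\<chi> ` (F \<inter> F') \<in> Q - {A}"
            using int g(3)[rule_format, of F F' A i] unfolding part_def ai by simp
        qed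
      qed (use H Q in \<open>auto simp: part_def\<close>)
      then show ?thesis by (meson Diff_subset subset_trans)
    qed
    then obtain \<P> where \<P>: "\<And>a. a \<in> Q \<times> {..<m} \<Longrightarrow> finite (\<P> a) \<and> card (\<P> a) \<le> N \<and>
        \<Union>(\<P> a) = part a \<and> (\<forall>P\<in>\<P> a. \<exists>Q'\<subseteq>Q. homogeneous \<chi> m Q' P)"
      by metis
    define \<R> where "\<R> = insert {F\<in>H. g F = None} (\<Union>a\<in>Q \<times> {..<m}. \<P> a)"
    have "card (\<Union>a\<in>Q \<times> {..<m}. \<P> a) \<le> (\<Sum>a\<in>Q \<times> {..<m}. card (\<P> a))"
      using finQ by (intro card_UN_le) auto
    also have "\<dots> \<le> (\<Sum>a\<in>Q \<times> {..<m}. N)"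
      using \<P> by (intro sum_mono) blast
    also have "\<dots> = Suc q * m * N"
      using Q(2) by (simp add: card_cartesian_product)
    finally have "card \<R> \<le> 1 + Suc q * m * N"
      unfolding \<R>_def using finQ \<P> by (subst card_insert_if) auto
    moreover have "finite \<R>"
      unfolding \<R>_def using finQ \<P> by auto
    moreover have "\<Union>\<R> = {F\<in>H. g F = None} \<union> (\<Union>a\<in>Q \<times> {..<m}. \<Union>(\<P> a))"
      unfolding \<R>_def by auto
    then have "\<Union>\<R> = {F\<in>H. g F = None} \<union> (\<Union>a\<in>Q \<times> {..<m}. part a)"
      using \<P> by auto
    moreover have "F \<in> (\<Union>a\<in>Q \<times> {..<m}. part a)" if "F \<in> H" "g F \<noteq> None" for F
    proof -
      have "g F \<in> insert None (Some ` (Q \<times> {..<m}))" using g(1) that(1) by (rule subsetD[OF _ imageI])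
      then show ?thesis using that unfolding part_def by auto
    qed
    then have "{F\<in>H. g F = None} \<union> (\<Union>a\<in>Q \<times> {..<m}. part a) = H"
      unfolding part_def by blast
    ultimately have UR: "\<Union>\<R> = H" "finite \<R>" "card \<R> \<le> 1 + Suc q * m * N"
      by simp_all
    have "homogeneous \<chi> m Q {F\<in>H. g F = None}"
      unfolding homogeneous_def using g(2) int by auto
    then have "\<forall>P\<in>\<R>. \<exists>Q'\<subseteq>Q. homogeneous \<chi> m Q' P"
      unfolding \<R>_def using \<P> by blast
    with UR show "\<exists>\<P>. finite \<P> \<and> card \<P> \<le> 1 + Suc q * m * N \<and> \<Union>\<P> = H \<and>
        (\<forall>P\<in>\<P>. \<exists>Q'\<subseteq>Q. homogeneous \<chi> m Q' P)"
      by blast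
  qed
qed

section \<open>Types of homogeneous families\<close>

lemma homogeneousD:
  assumes "homogeneous \<chi> m Q P" "F \<in> P"
  shows "A \<in> Q \<Longrightarrow> robust_kernel m P (F \<inter> \<chi> -` A)"
    and "F' \<in> P \<Longrightarrow> F \<noteq> F' \<Longrightarrow> \<chi> ` (F \<inter> F') \<in> Q"
  using assms unfolding homogeneous_def by simp_all

lemma rainbowE:
  assumes "bij_betw \<chi> F {..<k}" "c < k"
  obtains x where "x \<in> F" "\<chi> x = c"
proof -
  have "c \<in> \<chi> ` F" using assms by (simp add: bij_betw_def)
  then show ?thesis using that by blast
qed

text \<open>Take \<open>F1\<close> meeting \<open>F\<close> exactly in its part of type
  \<open>A\<close>, then \<open>F2\<close> containing the part of type \<open>B\<close> and avoiding
  the rest of \<open>F \<union> F1\<close>; these two meet in the part of type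
  \<open>A \<inter> B\<close>. The bound on \<open>m\<close> is the size of
  \<open>F \<union> F1\<close>.\<close>

lemma homogeneous_Int:
  assumes hom: "homogeneous \<chi> m Q P" and F: "F \<in> P"
    and rainbow: "\<And>F. F \<in> P \<Longrightarrow> bij_betw \<chi> F {..<k}"
    and AB: "A \<in> Q" "B \<in> Q" "A \<subset> {..<k}" "B \<subset> {..<k}" and m: "2 * k \<le> m"
  shows "A \<inter> B \<in> Q"
proof -
  have fin: "finite F" "card F = k" if "F \<in> P" for F
    using rainbow[OF that] bij_betw_finite bij_betw_same_card by fastforce+
  obtain F1 where F1: "F1 \<in> P" "F \<inter> \<chi> -` A \<subseteq> F1" "F1 \<inter> F \<subseteq> F \<inter> \<chi> -` A"
    using fin[OF F] m by (elim robust_kernelE[OF homogeneousD(1)[OF hom F AB(1)], of F]) auto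
  have "card (F \<union> F1) \<le> m"
    using card_Un_le[of F F1] fin[OF F] fin[OF F1(1)] m by simp
  then obtain F2 where F2: "F2 \<in> P" "F \<inter> \<chi> -` B \<subseteq> F2" "F2 \<inter> (F \<union> F1) \<subseteq> F \<inter> \<chi> -` B"
    using robust_kernelE[OF homogeneousD(1)[OF hom F AB(2)], of "F \<union> F1"] fin[OF F] fin[OF F1(1)]
    by blast
  have "F1 \<inter> F2 = F \<inter> \<chi> -` (A \<inter> B)"
    using F1 F2 by auto
  then have eq: "\<chi> ` (F1 \<inter> F2) = A \<inter> B"
    using image_vimage_rainbow[OF rainbow[OF F], of "A \<inter> B"] AB(3) by fastforce
  have "F1 \<noteq> F2"
  proof
    assume "F1 = F2"
    then have "A \<inter> B = {..<k}"
      using eq rainbow[OF F1(1)] by (simp add: bij_betw_def)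
    then show False using AB(3) by auto
  qed
  then show ?thesis
    using homogeneousD(2)[OF hom F1(1) F2(1)] eq by simp
qed

text \<open>An edge is determined by its part with colours in \<open>T\<close>: a second edge
  sharing that part would give an intersection type that contains \<open>T\<close>.\<close>

lemma card_le_uncovered_type:
  assumes hom: "homogeneous \<chi> m Q P"
    and rainbow: "\<And>F. F \<in> P \<Longrightarrow> bij_betw \<chi> F {..<k}"
    and T: "T \<subseteq> {..<k}" "\<And>B. B \<in> Q \<Longrightarrow> \<not> T \<subseteq> B"
    and P: "P \<subseteq> Pow V" "finite V"
  shows "card P \<le> card V ^ card T"
proof -
  have "inj_on (\<lambda>F. F \<inter> \<chi> -` T) P"
  proof (rule inj_onI, rule ccontr)
    fix F F' assume F: "F \<in> P" "F' \<in> P" and eq: "F \<inter> \<chi> -` T = F' \<inter> \<chi> -` T" and "F \<noteq> F'"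
    have "T = \<chi> ` (F \<inter> \<chi> -` T)"
      using image_vimage_rainbow[OF rainbow[OF F(1)] T(1)] by simp
    also have "\<dots> \<subseteq> \<chi> ` (F \<inter> F')"
      using eq by auto
    finally show False
      using T(2) homogeneousD(2)[OF hom F \<open>F \<noteq> F'\<close>] by blast
  qed
  moreover have "(\<lambda>F. F \<inter> \<chi> -` T) ` P \<subseteq> {X. X \<subseteq> V \<and> card X = card T}"
  proof (rule image_subsetI)
    fix F assume F: "F \<in> P"
    have "inj_on \<chi> (F \<inter> \<chi> -` T)"
      using rainbow[OF F] by (auto simp: bij_betw_def inj_on_def)
    then have "card (F \<inter> \<chi> -` T) = card T"
      using image_vimage_rainbow[OF rainbow[OF F] T(1)] card_image by metis
    then show "F \<inter> \<chi> -` T \<in> {X. X \<subseteq> V \<and> card X = card T}"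
      using F P(1) by auto
  qed
  ultimately have "card P \<le> card {X. X \<subseteq> V \<and> card X = card T}"
    using P(2) by (intro card_inj_on_le) auto
  also have "\<dots> = card V choose card T"
    using n_subsets[OF P(2)] by simp
  also have "\<dots> \<le> card V ^ card T"
    by (cases "card T \<le> card V") (auto simp: binomial_le_pow binomial_eq_0)
  finally show ?thesis .
qed

text \<open>If all complements of single colours other than \<open>c\<close> are types, intersecting
  them gives the first case. Otherwise two colours \<open>w1\<close>, \<open>w2\<close> have
  complements that are not types, and every set avoiding both is a type; \<open>k \<ge> 5\<close>
  leaves three colours for \<open>R\<close>.\<close>

lemma type_dichotomy:
  assumes k: "5 \<le> k"
    and Q: "\<And>A. A \<in> Q \<Longrightarrow> A \<subset> {..<k}"
    and closed: "\<And>A B. A \<in> Q \<Longrightarrow> B \<in> Q \<Longrightarrow> A \<inter> B \<in> Q"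
    and cover: "\<And>T. T \<subseteq> {..<k} \<Longrightarrow> card T = k - 2 \<Longrightarrow> \<exists>B\<in>Q. T \<subseteq> B"
  shows "(\<exists>c<k. \<forall>A. c \<in> A \<and> A \<subset> {..<k} \<longrightarrow> A \<in> Q) \<or>
    (\<exists>R. R \<subseteq> {..<k} \<and> card R = 3 \<and> (\<forall>A\<subseteq>R. card A = 2 \<longrightarrow> A \<in> Q))"
proof -
  have Inter: "finite \<U> \<Longrightarrow> \<U> \<noteq> {} \<Longrightarrow> \<U> \<subseteq> Q \<Longrightarrow> \<Inter>\<U> \<in> Q" for \<U>
    by (induction \<U> rule: finite_ne_induct) (auto intro: closed)
  show ?thesis
  proof (cases "\<exists>c<k. \<forall>x<k. x \<noteq> c \<longrightarrow> {..<k} - {x} \<in> Q")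
    case True
    then obtain c where c: "c < k" "\<And>x. x < k \<Longrightarrow> x \<noteq> c \<Longrightarrow> {..<k} - {x} \<in> Q"
      by blast
    have "A \<in> Q" if A: "c \<in> A" "A \<subset> {..<k}" for A
    proof -
      have "A = (\<Inter>x\<in>{..<k} - A. {..<k} - {x})" using A by auto
      also have "\<dots> \<in> Q"
        using A c by (intro Inter) auto
      finally show ?thesis .
    qed
    then show ?thesis using c by blast
  next
    case False
    obtain w1 where w1: "w1 < k" "{..<k} - {w1} \<notin> Q"
      using False k by force
    obtain w2 where w2: "w2 < k" "{..<k} - {w2} \<notin> Q" "w2 \<noteq> w1"
      using False w1 by blast
    \<comment> \<open>A type covering the complement of \<open>{u, w1}\<close> is proper, so if it
      contained \<open>u\<close> or \<open>w1\<close> it would be one of the two missing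
      complements.\<close>
    have two: "{..<k} - {u, w1} \<in> Q" if u: "u < k" "u \<noteq> w1" "{..<k} - {u} \<notin> Q" for u
    proof -
      have "card ({..<k} - {u, w1}) = k - 2"
        using u w1 by (subst card_Diff_subset) auto
      then obtain B where B: "B \<in> Q" "{..<k} - {u, w1} \<subseteq> B"
        using cover[of "{..<k} - {u, w1}"] by auto
      have "u \<notin> B" "w1 \<notin> B"
      proof -
        show "u \<notin> B"
        proof
          assume "u \<in> B"
          then have "B = {..<k} - {w1}" using B Q[OF B(1)] by auto
          then show False using w1 B by simp
        qed
        show "w1 \<notin> B"
        proof
          assume "w1 \<in> B"
          then have "B = {..<k} - {u}" using B Q[OF B(1)] by auto
          then show False using u B by simp
        qed
      qed
      then have "B = {..<k} - {u, w1}" using B Q[OF B(1)] by auto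
      then show ?thesis using B by simp
    qed
    \<comment> \<open>\<open>w1\<close> needs no set of its own, as \<open>h w2\<close> omits both \<open>w1\<close> and \<open>w2\<close>\<close>
    have avoid: "A \<in> Q" if A: "A \<subseteq> {..<k} - {w1, w2}" for A
    proof -
      define h where "h u = (if {..<k} - {u} \<in> Q then {..<k} - {u} else {..<k} - {u, w1})" for u
      have hQ: "h u \<in> Q" if "u < k" "u \<noteq> w1" for u
        using two that unfolding h_def by auto
      have "h w2 = {..<k} - {w2, w1}" using w2 by (simp add: h_def)
      then have w2': "h w2 \<subseteq> {..<k} - {w1}" by auto
      have "x \<in> A" if x: "x \<in> \<Inter>(h ` ({..<k} - A - {w1}))" for x
      proof (rule ccontr)
        assume "x \<notin> A"
        have "w2 \<in> {..<k} - A - {w1}" using A w2 by auto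
        then have "x \<in> h w2" using x by blast
        then have "x \<in> {..<k} - A - {w1}" using w2' \<open>x \<notin> A\<close> by auto
        then have "x \<in> h x" using x by blast
        then show False by (simp add: h_def split: if_splits)
      qed
      then have "\<Inter>(h ` ({..<k} - A - {w1})) \<subseteq> A" by blast
      moreover have "A \<subseteq> \<Inter>(h ` ({..<k} - A - {w1}))"
        using A by (auto simp: h_def)
      ultimately have "A = \<Inter>(h ` ({..<k} - A - {w1}))" by blast
      also have "\<dots> \<in> Q"
        using hQ A w2 by (intro Inter) auto
      finally show ?thesis .
    qed
    have "3 \<le> card ({..<k} - {w1, w2})"
      using k w1 w2 by (subst card_Diff_subset) auto
    then obtain R where "R \<subseteq> {..<k} - {w1, w2}" "card R = 3"
      by (meson obtain_subset_with_card_n)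
    then show ?thesis using avoid by (intro disjI2 exI[of _ R]) auto
  qed
qed

text \<open>Two vertices of one edge with colours in \<open>R\<close> form a robust kernel. Three
  such vertices of one edge give a triangle, which is then lengthened one vertex at a time.\<close>

lemma triangle_type_cycle:
  assumes hom: "homogeneous \<chi> m Q P" and P: "P \<noteq> {}" "P \<subseteq> H"
    and rainbow: "\<And>F. F \<in> P \<Longrightarrow> bij_betw \<chi> F {..<k}"
    and R: "R \<subseteq> {..<k}" "card R = 3" "\<And>A. A \<subseteq> R \<Longrightarrow> card A = 2 \<Longrightarrow> A \<in> Q"
    and unif: "uniform_hypergraph k (V, H)" and l: "3 \<le> l" and k: "2 \<le> k" and m: "l * (k + 3) \<le> m"
  shows "contains_copy (V, H) (linear_cycle k l)"
proof -
  define J where "J u v \<longleftrightarrow> u \<noteq> v \<and> (\<exists>F\<in>P. {u, v} \<subseteq> F \<inter> \<chi> -` R)" for u v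
  have J: "robust_kernel m P {u, v} \<and> {\<chi> u, \<chi> v} \<subseteq> R \<and> \<chi> u \<noteq> \<chi> v" if uv: "J u v" for u v
  proof -
    from uv obtain F where F: "F \<in> P" "u \<in> F" "v \<in> F" "\<chi> u \<in> R" "\<chi> v \<in> R" "u \<noteq> v"
      unfolding J_def by auto
    have inj: "inj_on \<chi> F" using rainbow[OF F(1)] by (simp add: bij_betw_def)
    then have ne: "\<chi> u \<noteq> \<chi> v" using F by (auto dest: inj_onD)
    have "F \<inter> \<chi> -` {\<chi> u, \<chi> v} = {u, v}"
      using vimage_image_rainbow[OF inj, of "{u, v}"] F by simp
    then have "robust_kernel m P {u, v}"
      using homogeneousD(1)[OF hom F(1) R(3), of "{\<chi> u, \<chi> v}"] F ne by simp
    then show ?thesis using F ne by simp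
  qed
  have "\<exists>v. inj_on v {..<j} \<and> (\<forall>i<j. J (v i) (v (Suc i mod j)))" if "3 \<le> j" "j \<le> l" for j
    using that
  proof (induction j rule: nat_induct_at_least)
    case base
    obtain F where F: "F \<in> P" using P by blast
    obtain p q r where pqr: "R = {p, q, r}" "p \<noteq> q" "q \<noteq> r" "p \<noteq> r"
      using R(2) by (auto simp: card_3_iff)
    then have "p < k" "q < k" "r < k" using R(1) by auto
    then obtain x y z where xyz: "x \<in> F" "y \<in> F" "z \<in> F" "\<chi> x = p" "\<chi> y = q" "\<chi> z = r"
      using rainbowE[OF rainbow[OF F]] by metis
    have neq: "x \<noteq> y" "y \<noteq> z" "x \<noteq> z" using pqr xyz by auto
    have JJ: "J x y" "J y z" "J z x"
      unfolding J_def using neq xyz F pqr by (auto intro!: bexI[of _ F])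
    define v where "v i = (if i = 0 then x else if i = 1 then y else z)" for i :: nat
    have "inj_on v {..<3}"
      unfolding inj_on_def v_def using neq by auto
    moreover have "J (v i) (v (Suc i mod 3))" if "i < 3" for i
    proof -
      from that have "i = 0 \<or> i = 1 \<or> i = 2" by auto
      then show ?thesis using JJ by (auto simp: v_def)
    qed
    ultimately show ?case by blast
  next
    case (Suc j)
    then obtain v where v: "inj_on v {..<j}" "\<And>i. i < j \<Longrightarrow> J (v i) (v (Suc i mod j))"
      by auto
    define a where "a = v (j - 1)"
    have jj: "Suc (j - 1) = j" "j - 1 < j" using Suc.hyps by auto
    have "J a (v 0)" using v(2)[OF jj(2)] unfolding jj(1) a_def by simp
    note Ja = J[OF this]
    \<comment> \<open>As \<open>m\<close> exceeds the current length, a new edge through the closing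
      pair \<open>a\<close>, \<open>v 0\<close> avoids the rest of the cycle; its vertex of the
      third colour of \<open>R\<close> is inserted between the two.\<close>
    have "l * 1 \<le> l * (k + 3)" by (intro mult_left_mono) auto
    then have "l \<le> m" using m by linarith
    then have "card (v ` {..<j}) \<le> m"
      using card_image_le[of "{..<j}" v] Suc.prems by simp
    then obtain F where F: "F \<in> P" "{a, v 0} \<subseteq> F" "F \<inter> v ` {..<j} \<subseteq> {a, v 0}"
      using Ja by (auto elim: robust_kernelE[of m P "{a, v 0}" "v ` {..<j}"])
    have "card (R - {\<chi> a, \<chi> (v 0)}) = 1"
      using Ja R(2) by (subst card_Diff_subset) auto
    then obtain d where d: "d \<in> R" "d \<noteq> \<chi> a" "d \<noteq> \<chi> (v 0)"
      by (metis (no_types, lifting) Diff_iff card.empty ex_in_conv insertCI zero_neq_one)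
    obtain z where z: "z \<in> F" "\<chi> z = d"
      using rainbowE[OF rainbow[OF F(1)], of d] R(1) d(1) by blast
    have zn: "z \<notin> v ` {..<j}" using F(3) z d by auto
    have Jz: "J a z" "J z (v 0)"
      unfolding J_def using z d F Ja by (auto intro!: bexI[of _ F])
    define v' where "v' = v(j := z)"
    have "inj_on v' {..<Suc j}"
      unfolding v'_def lessThan_Suc using v(1) zn by (auto simp: inj_on_def image_iff)
    moreover have "J (v' i) (v' (Suc i mod Suc j))" if "i < Suc j" for i
    proof -
      have "i = j \<or> i = j - 1 \<and> i < j \<or> Suc i < j" using that by arith
      then consider "i = j" | "i = j - 1" "i < j" | "Suc i < j" by blast
      then show ?thesis
      proof cases
        case 1 then show ?thesis using Jz Suc.hyps by (simp add: v'_def)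
      next
        case 2 then show ?thesis using Jz Suc.hyps by (auto simp: v'_def a_def)
      next
        case 3 then show ?thesis using v(2)[of i] by (simp add: v'_def)
      qed
    qed
    ultimately show ?case by blast
  qed
  then obtain v where v: "inj_on v {..<l}" "\<And>i. i < l \<Longrightarrow> J (v i) (v (Suc i mod l))"
    using l by blast
  show ?thesis
  proof (rule contains_linear_cycle[OF l k unif v(1), where A = "\<lambda>i. {v i, v (Suc i mod l)}"])
    show "robust_kernel m H {v i, v (Suc i mod l)}" if "i < l" for i
      using J[OF v(2)[OF that]] robust_kernel_mono[OF _ P(2)] by blast
    show "finite {v i, v (Suc i mod l)} \<and> card {v i, v (Suc i mod l)} \<le> 3" for i
      using card_insert_le_m1[of 2 "{v (Suc i mod l)}" "v i"] by simp
  qed (use m in auto)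
qed

text \<open>The case \<open>y = y'\<close> is included, so the pairs \<open>{x, y}\<close> are
  robust kernels as well. Only kernels of at most three vertices matter, which is why they can all
  be listed with \<open>n ^ 3\<close> bits.\<close>

definition centered :: "nat \<Rightarrow> 'a set set \<Rightarrow> 'a set \<Rightarrow> bool" where
  "centered m H F \<longleftrightarrow> (\<exists>x\<in>F. \<forall>y\<in>F - {x}. \<forall>y'\<in>F - {x}. robust_kernel m H {x, y, y'})"

text \<open>As \<open>k > 3\<close>, the colours of \<open>{x, y, y'}\<close> form a proper subset
  of \<open>{..<k}\<close> containing \<open>c\<close>, hence a type.\<close>

lemma centered_type:
  assumes hom: "homogeneous \<chi> m Q P" and F: "F \<in> P" and P: "P \<subseteq> H"
    and rainbow: "bij_betw \<chi> F {..<k}" and k: "3 < k"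
    and c: "c < k" "\<And>A. c \<in> A \<Longrightarrow> A \<subset> {..<k} \<Longrightarrow> A \<in> Q"
  shows "centered m H F"
proof -
  obtain x where x: "x \<in> F" "\<chi> x = c"
    using rainbowE[OF rainbow c(1)] .
  have "robust_kernel m H {x, y, y'}" if "y \<in> F" "y' \<in> F" for y y'
  proof -
    have inj: "inj_on \<chi> F" using rainbow by (simp add: bij_betw_def)
    have "card (\<chi> ` {x, y, y'}) \<le> card {x, y, y'}" by (rule card_image_le) simp
    also have "\<dots> \<le> 3" by (simp add: card_insert_if)
    finally have "card (\<chi> ` {x, y, y'}) \<noteq> card {..<k}" using k by simp
    then have "\<chi> ` {x, y, y'} \<noteq> {..<k}" by metis
    moreover have "\<chi> ` {x, y, y'} \<subseteq> {..<k}"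
      using rainbow that x by (auto simp: bij_betw_def)
    ultimately have "\<chi> ` {x, y, y'} \<in> Q"
      using x by (intro c(2)) auto
    moreover have "F \<inter> \<chi> -` (\<chi> ` {x, y, y'}) = {x, y, y'}"
      using that x by (intro vimage_image_rainbow[OF inj]) auto
    ultimately have "robust_kernel m P {x, y, y'}"
      using homogeneousD(1)[OF hom F] by metis
    then show ?thesis using robust_kernel_mono P by metis
  qed
  then show ?thesis unfolding centered_def using x by blast
qed

text \<open>If some \<open>k - 2\<close> colours lie in no type, the family is small. Otherwise
  \<open>type_dichotomy\<close> applies, and its second case is excluded by
  \<open>triangle_type_cycle\<close>.\<close>

lemma homogeneous_small_or_centered:
  assumes hom: "homogeneous \<chi> m Q P" and P: "P \<subseteq> H"
    and rainbow: "\<And>F. F \<in> P \<Longrightarrow> bij_betw \<chi> F {..<k}"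
    and Q: "\<And>A. A \<in> Q \<Longrightarrow> A \<subset> {..<k}"
    and unif: "uniform_hypergraph k (V, H)" and l: "3 \<le> l" and k: "5 \<le> k" and m: "l * (k + 3) \<le> m"
    and free: "\<not> contains_copy (V, H) (linear_cycle k l)" and V: "finite V"
  shows "card P \<le> card V ^ (k - 2) \<or> (\<forall>F\<in>P. centered m H F)"
proof (cases "P = {} \<or> (\<exists>T\<subseteq>{..<k}. card T = k - 2 \<and> (\<forall>B\<in>Q. \<not> T \<subseteq> B))")
  case True
  have "P \<subseteq> Pow V" using unif P by (auto simp: uniform_hypergraph_def)
  show ?thesis
    using True
  proof (elim disjE exE conjE)
    fix T assume "T \<subseteq> {..<k}" "card T = k - 2" "\<forall>B\<in>Q. \<not> T \<subseteq> B"
    then show ?thesis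
      using card_le_uncovered_type[OF hom rainbow _ _ \<open>P \<subseteq> Pow V\<close> V, where T = T] by auto
  qed simp
next
  case False
  have "2 * k \<le> 3 * (k + 3)" by simp
  also have "\<dots> \<le> l * (k + 3)" using l by (intro mult_right_mono) auto
  finally have m2: "2 * k \<le> m" using m by simp
  obtain F0 where F0: "F0 \<in> P" using False by blast
  have closed: "A \<inter> B \<in> Q" if "A \<in> Q" "B \<in> Q" for A B
    by (rule homogeneous_Int[OF hom F0 rainbow that Q[OF that(1)] Q[OF that(2)] m2])
  have "\<exists>c<k. \<forall>A. c \<in> A \<and> A \<subset> {..<k} \<longrightarrow> A \<in> Q"
  proof -
    have "\<not> (\<exists>R. R \<subseteq> {..<k} \<and> card R = 3 \<and> (\<forall>A\<subseteq>R. card A = 2 \<longrightarrow> A \<in> Q))"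
    proof
      assume "\<exists>R. R \<subseteq> {..<k} \<and> card R = 3 \<and> (\<forall>A\<subseteq>R. card A = 2 \<longrightarrow> A \<in> Q)"
      then obtain R where "R \<subseteq> {..<k}" "card R = 3" "\<And>A. A \<subseteq> R \<Longrightarrow> card A = 2 \<Longrightarrow> A \<in> Q" by blast
      note R = this
      have "contains_copy (V, H) (linear_cycle k l)"
        by (rule triangle_type_cycle[OF hom _ P rainbow R unif l _ m]) (use F0 k in auto)
      then show False using free by simp
    qed
    then show ?thesis
      using type_dichotomy[OF k Q closed] False by blast
  qed
  then obtain c where "c < k" "\<And>A. c \<in> A \<Longrightarrow> A \<subset> {..<k} \<Longrightarrow> A \<in> Q" by blast
  then have "\<forall>F\<in>P. centered m H F"
    using centered_type[OF hom _ P rainbow, of _ c] k by auto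
  then show ?thesis ..
qed

text \<open>Decompose the rainbow edges into homogeneous parts. Only small parts can contain an edge
  that is not centered, and the bound \<open>N\<close> on the number of parts is uniform in the
  colouring and the hypergraph.\<close>

lemma few_rainbow_noncentered:
  fixes k l m :: nat
  assumes l: "3 \<le> l" and k: "5 \<le> k" and m: "l * (k + 3) \<le> m"
  shows "\<exists>N. \<forall>(\<chi> :: 'a \<Rightarrow> nat) V H. finite V \<longrightarrow> uniform_hypergraph k (V, H) \<longrightarrow>
    \<not> contains_copy (V, H) (linear_cycle k l) \<longrightarrow>
    card {F\<in>H. bij_betw \<chi> F {..<k} \<and> \<not> centered m H F} \<le> N * card V ^ (k - 2)"
proof -
  define Q where "Q = {A. A \<subset> {..<k}}"
  obtain N where N: "\<And>(\<chi> :: 'a \<Rightarrow> nat) H. finite H \<Longrightarrow> \<forall>F\<in>H. bij_betw \<chi> F {..<k} \<Longrightarrow>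
    \<forall>F\<in>H. \<forall>F'\<in>H. F \<noteq> F' \<longrightarrow> \<chi> ` (F \<inter> F') \<in> Q \<Longrightarrow>
    \<exists>\<P>. finite \<P> \<and> card \<P> \<le> N \<and> \<Union>\<P> = H \<and> (\<forall>P\<in>\<P>. \<exists>Q'\<subseteq>Q. homogeneous \<chi> m Q' P)"
  proof -
    have "Q \<subseteq> Pow {..<k}" by (auto simp: Q_def)
    then show ?thesis
      using homogeneous_decomposition[of k "card Q" m] that by metis
  qed
  show ?thesis
  proof (intro exI[of _ N] allI impI)
    fix \<chi> :: "'a \<Rightarrow> nat" and V :: "'a set" and H
    assume V: "finite V" and unif: "uniform_hypergraph k (V, H)"
      and free: "\<not> contains_copy (V, H) (linear_cycle k l)"
    define H' where "H' = {F\<in>H. bij_betw \<chi> F {..<k}}"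
    have "H \<subseteq> Pow V" using unif by (auto simp: uniform_hypergraph_def)
    then have fin: "finite H'" using V finite_subset[of H "Pow V"] by (auto simp: H'_def)
    have r: "\<forall>F\<in>H'. bij_betw \<chi> F {..<k}" by (simp add: H'_def)
    have "\<chi> ` (F \<inter> F') \<in> Q" if F: "F \<in> H'" "F' \<in> H'" "F \<noteq> F'" for F F'
    proof -
      have "card F = card F'" "finite F" "finite F'"
        using F unif by (auto simp: H'_def uniform_hypergraph_def)
      then have "F \<inter> F' \<subset> F"
        using F(3) by (metis card_subset_eq inf.absorb_iff1 inf_le1 psubsetI)
      then obtain x where x: "x \<in> F" "x \<notin> F'" by blast
      have b: "inj_on \<chi> F" "\<chi> ` F = {..<k}" using r F(1) by (auto simp: bij_betw_def)
      then have "\<chi> x \<notin> \<chi> ` (F \<inter> F')" using x by (auto dest: inj_onD)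
      then show ?thesis unfolding Q_def using b x by blast
    qed
    then obtain \<P> where \<P>: "finite \<P>" "card \<P> \<le> N" "\<Union>\<P> = H'"
        "\<And>P. P \<in> \<P> \<Longrightarrow> \<exists>Q'\<subseteq>Q. homogeneous \<chi> m Q' P"
      using N[OF fin r] by metis
    define \<S> where "\<S> = {P\<in>\<P>. card P \<le> card V ^ (k - 2)}"
    have "{F\<in>H. bij_betw \<chi> F {..<k} \<and> \<not> centered m H F} \<subseteq> \<Union>\<S>"
    proof
      fix F assume F: "F \<in> {F\<in>H. bij_betw \<chi> F {..<k} \<and> \<not> centered m H F}"
      then have "F \<in> \<Union>\<P>" unfolding \<P>(3) H'_def by simp
      then obtain P where P: "P \<in> \<P>" "F \<in> P" by blast
      then obtain Q' where Q': "Q' \<subseteq> Q" "homogeneous \<chi> m Q' P" using \<P>(4) by blast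
      have "P \<subseteq> H'" using P(1) \<P>(3) by blast
      then have "P \<subseteq> H" "\<And>F. F \<in> P \<Longrightarrow> bij_betw \<chi> F {..<k}" by (auto simp: H'_def)
      then have "card P \<le> card V ^ (k - 2) \<or> (\<forall>F\<in>P. centered m H F)"
        using homogeneous_small_or_centered[OF Q'(2) _ _ _ unif l k m free V] Q'(1)
        unfolding Q_def by blast
      then show "F \<in> \<Union>\<S>" unfolding \<S>_def using F P by blast
    qed
    moreover have fS: "finite (\<Union>\<S>)"
      by (rule finite_subset[OF _ fin]) (use \<P>(3) in \<open>auto simp: \<S>_def\<close>)
    ultimately have "card {F\<in>H. bij_betw \<chi> F {..<k} \<and> \<not> centered m H F} \<le> card (\<Union>\<S>)"
      by (intro card_mono)
    also have "\<dots> \<le> (\<Sum>P\<in>\<S>. card P)"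
      by (rule card_Union_le_sum_card)
    also have "\<dots> \<le> (\<Sum>P\<in>\<S>. card V ^ (k - 2))"
      by (intro sum_mono) (simp add: \<S>_def)
    also have "\<dots> \<le> N * card V ^ (k - 2)"
      using card_mono[of \<P> \<S>] \<P>(1,2) by (auto simp: \<S>_def intro!: mult_right_mono)
    finally show "card {F\<in>H. bij_betw \<chi> F {..<k} \<and> \<not> centered m H F} \<le> N * card V ^ (k - 2)" .
  qed
qed

section \<open>Few edges are not centered\<close>

text \<open>The parameter \<open>\<phi>\<close> prescribes, for each pair of vertices of a target edge, a binary digit in
  which they differ; there are only \<open>(2 * b) ^ (k * k)\<close> choices of it for vertices below \<open>2 ^ b\<close>.\<close>

definition bit_colouring :: "nat \<Rightarrow> (nat \<times> nat \<Rightarrow> nat \<times> bool) \<Rightarrow> nat \<Rightarrow> nat" where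
  "bit_colouring k \<phi> v =
     (LEAST i. \<forall>j<k. j \<noteq> i \<longrightarrow> bit v (fst (\<phi> (i, j))) = snd (\<phi> (i, j)))"

text \<open>Enumerate \<open>F\<close> by \<open>f\<close> and let \<open>\<phi> (i, j)\<close> be a
  digit in which \<open>f i\<close> and \<open>f j\<close> differ, with its value at
  \<open>f i\<close>. Then \<open>f i\<close> passes the test of colour \<open>i\<close> and fails
  that of each smaller colour.\<close>

lemma ex_rainbow_bit_colouring:
  assumes F: "F \<subseteq> {..<2 ^ b}" "card F = k" "finite F" and b: "0 < b"
  shows "\<exists>\<phi> \<in> {..<k} \<times> {..<k} \<rightarrow>\<^sub>E {..<b} \<times> UNIV. bij_betw (bit_colouring k \<phi>) F {..<k}"
proof -
  obtain f where f: "bij_betw f {..<k} F"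
    using ex_bij_betw_nat_finite[OF F(3)] F(2) by (auto simp: atLeast0LessThan)
  have f_in: "f i \<in> F" if "i < k" for i using f that by (auto simp: bij_betw_def)
  have f_inj: "f i \<noteq> f j" if "i < k" "j < k" "i \<noteq> j" for i j
    using f that by (auto simp: bij_betw_def dest: inj_onD)
  have "\<exists>d<b. bit (f i) d \<noteq> bit (f j) d" if ij: "i < k" "j < k" "i \<noteq> j" for i j
  proof (rule ccontr)
    assume *: "\<not> ?thesis"
    have "take_bit b (f i) = take_bit b (f j)"
      using * by (intro bit_eqI) (auto simp: bit_take_bit_iff)
    moreover have "f i < 2 ^ b" "f j < 2 ^ b" using f_in ij F(1) by auto
    ultimately show False using f_inj[OF ij] by (simp add: take_bit_nat_eq_self)
  qed
  then obtain d where d: "\<And>i j. i < k \<Longrightarrow> j < k \<Longrightarrow> i \<noteq> j \<Longrightarrow> d i j < b \<and> bit (f i) (d i j) \<noteq> bit (f j) (d i j)"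
    by metis
  \<comment> \<open>The diagonal value is a dummy; its digit \<open>0\<close> is below
    \<open>b\<close> because \<open>0 < b\<close>.\<close>
  define \<phi> where "\<phi> = restrict (\<lambda>(i, j). if i = j then (0, True) else (d i j, bit (f i) (d i j))) ({..<k} \<times> {..<k})"
  have "\<phi> \<in> {..<k} \<times> {..<k} \<rightarrow>\<^sub>E {..<b} \<times> UNIV"
    unfolding \<phi>_def using d b by auto
  moreover have col: "bit_colouring k \<phi> (f i) = i" if i: "i < k" for i
    unfolding bit_colouring_def
  proof (rule Least_equality)
    show "\<forall>j<k. j \<noteq> i \<longrightarrow> bit (f i) (fst (\<phi> (i, j))) = snd (\<phi> (i, j))"
      using i by (auto simp: \<phi>_def)
  next
    fix i' assume *: "\<forall>j<k. j \<noteq> i' \<longrightarrow> bit (f i) (fst (\<phi> (i', j))) = snd (\<phi> (i', j))"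
    show "i \<le> i'"
    proof (rule ccontr)
      assume "\<not> i \<le> i'"
      then have "bit (f i) (d i' i) = bit (f i') (d i' i)"
        using *[rule_format, of i] i by (simp add: \<phi>_def)
      then show False using d[of i' i] i \<open>\<not> i \<le> i'\<close> by auto
    qed
  qed
  then have "bij_betw (bit_colouring k \<phi>) F {..<k}"
    using f by (intro bij_betw_byWitness[where f' = f]) (auto simp: bij_betw_def)
  ultimately show ?thesis by blast
qed

text \<open>Sum \<open>few_rainbow_noncentered\<close> over all \<open>\<phi>\<close>: every edge is
  rainbow for one of the colourings.\<close>

lemma few_noncentered:
  fixes k l m :: nat
  assumes l: "3 \<le> l" and k: "5 \<le> k" and m: "l * (k + 3) \<le> m"
  shows "\<exists>N. \<forall>n b H. n < 2 ^ b \<longrightarrow> 0 < b \<longrightarrow> uniform_hypergraph k ({1..n}, H) \<longrightarrow>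
    \<not> contains_copy ({1..n}, H) (linear_cycle k l) \<longrightarrow>
    card {F\<in>H. \<not> centered m H F} \<le> N * (2 * b) ^ (k * k) * n ^ (k - 2)"
proof -
  obtain N where N: "\<And>(\<chi> :: nat \<Rightarrow> nat) V H. finite V \<Longrightarrow> uniform_hypergraph k (V, H) \<Longrightarrow>
    \<not> contains_copy (V, H) (linear_cycle k l) \<Longrightarrow>
    card {F\<in>H. bij_betw \<chi> F {..<k} \<and> \<not> centered m H F} \<le> N * card V ^ (k - 2)"
    using few_rainbow_noncentered[OF assms] by blast
  show ?thesis
  proof (intro exI[of _ N] allI impI)
    fix n b :: nat and H
    assume n: "n < 2 ^ b" and b: "0 < b" and unif: "uniform_hypergraph k ({1..n}, H)"
      and free: "\<not> contains_copy ({1..n}, H) (linear_cycle k l)"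
    define \<Phi> where "\<Phi> = {..<k} \<times> {..<k} \<rightarrow>\<^sub>E {..<b} \<times> (UNIV :: bool set)"
    have \<Phi>: "finite \<Phi>" "card \<Phi> = (2 * b) ^ (k * k)"
      unfolding \<Phi>_def by (auto intro!: finite_PiE simp: card_funcsetE card_cartesian_product mult.commute)
    define part where "part \<phi> = {F\<in>H. bij_betw (bit_colouring k \<phi>) F {..<k} \<and> \<not> centered m H F}" for \<phi>
    have "H \<subseteq> Pow {1..n}" using unif by (auto simp: uniform_hypergraph_def)
    then have fin: "finite H" using finite_subset by blast
    have "{F\<in>H. \<not> centered m H F} \<subseteq> (\<Union>\<phi>\<in>\<Phi>. part \<phi>)"
    proof
      fix F assume F: "F \<in> {F\<in>H. \<not> centered m H F}"
      then have "finite F" "card F = k" "F \<subseteq> {1..n}" using unif by (auto simp: uniform_hypergraph_def)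
      moreover from this(3) have "F \<subseteq> {..<2 ^ b}" using n by auto
      ultimately obtain \<phi> where "\<phi> \<in> \<Phi>" "bij_betw (bit_colouring k \<phi>) F {..<k}"
        using ex_rainbow_bit_colouring[of F b k] b unfolding \<Phi>_def by blast
      then show "F \<in> (\<Union>\<phi>\<in>\<Phi>. part \<phi>)" using F unfolding part_def by blast
    qed
    then have "card {F\<in>H. \<not> centered m H F} \<le> card (\<Union>\<phi>\<in>\<Phi>. part \<phi>)"
      using fin \<Phi>(1) by (intro card_mono) (auto simp: part_def)
    also have "\<dots> \<le> (\<Sum>\<phi>\<in>\<Phi>. card (part \<phi>))"
      by (rule card_UN_le[OF \<Phi>(1)])
    also have "\<dots> \<le> (\<Sum>\<phi>\<in>\<Phi>. N * n ^ (k - 2))"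
      using N[OF _ unif free] unfolding part_def by (intro sum_mono) simp
    also have "\<dots> = N * (2 * b) ^ (k * k) * n ^ (k - 2)"
      using \<Phi>(2) by simp
    finally show "card {F\<in>H. \<not> centered m H F} \<le> N * (2 * b) ^ (k * k) * n ^ (k - 2)" .
  qed
qed

section \<open>Few possible centered edges\<close>

text \<open>The neighbourhood of \<open>v\<close> in the shadow graph, whose edges are the pairs
  inside members of \<open>P\<close>.\<close>

definition nbhd :: "'a set set \<Rightarrow> 'a \<Rightarrow> 'a set" where
  "nbhd P v = \<Union>{S\<in>P. v \<in> S} - {v}"

text \<open>Delete vertices with at most \<open>t\<close> neighbours. Each deletion costs at most
  \<open>2 ^ t\<close> sets, as a set through \<open>v\<close> is determined by its trace on the
  neighbourhood, so not everything is deleted.\<close>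

lemma nbhd_core:
  assumes "finite B" "P \<subseteq> Pow B" "{} \<notin> P" "2 ^ t * card B < card P"
  shows "\<exists>P'\<subseteq>P. \<Union>P' \<noteq> {} \<and> (\<forall>v\<in>\<Union>P'. t < card (nbhd P' v))"
  using assms
proof (induction "card B" arbitrary: B P)
  case 0
  then have "P = {}" by (auto simp: subset_singleton_iff)
  then show ?case using 0 by simp
next
  case (Suc n)
  show ?case
  proof (cases "\<forall>v\<in>\<Union>P. t < card (nbhd P v)")
    case True
    moreover have "P \<noteq> {}" using Suc.prems by auto
    then have "\<Union>P \<noteq> {}" using Suc.prems(3) by auto
    ultimately show ?thesis by blast
  next
    case False
    then obtain v where v: "v \<in> \<Union>P" "card (nbhd P v) \<le> t" by force
    have vB: "v \<in> B" using v Suc.prems by auto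
    have finP: "finite P" using Suc.prems finite_subset[of P "Pow B"] by auto
    have finN: "finite (nbhd P v)"
      using Suc.prems unfolding nbhd_def by (intro finite_subset[OF _ Suc.prems(1)]) auto
    define P1 where "P1 = {S\<in>P. v \<notin> S}"
    have "inj_on (\<lambda>S. S - {v}) {S\<in>P. v \<in> S}"
      by (auto simp: inj_on_def)
    moreover have "(\<lambda>S. S - {v}) ` {S\<in>P. v \<in> S} \<subseteq> Pow (nbhd P v)"
      unfolding nbhd_def by auto
    ultimately have "card {S\<in>P. v \<in> S} \<le> card (Pow (nbhd P v))"
      using finN by (intro card_inj_on_le) auto
    also have "\<dots> \<le> 2 ^ t" using v(2) finN by (simp add: card_Pow)
    finally have "card {S\<in>P. v \<in> S} \<le> 2 ^ t" .
    moreover have "card P = card P1 + card {S\<in>P. v \<in> S}"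
      unfolding P1_def using finP by (subst card_Un_disjoint[symmetric]) (auto intro: arg_cong[where f = card])
    moreover have "2 ^ t * card B = 2 ^ t * card (B - {v}) + 2 ^ t"
      using Suc.hyps(2) vB Suc.prems(1) by (simp add: card_Diff_singleton algebra_simps)
    ultimately have "2 ^ t * card (B - {v}) < card P1"
      using Suc.prems(4) by linarith
    moreover have "n = card (B - {v})" using Suc.hyps(2) vB by simp
    moreover have "P1 \<subseteq> Pow (B - {v})" "{} \<notin> P1" using Suc.prems by (auto simp: P1_def)
    ultimately obtain P' where "P' \<subseteq> P1" "\<Union>P' \<noteq> {}" "\<forall>v\<in>\<Union>P'. t < card (nbhd P' v)"
      using Suc.hyps(1)[of "B - {v}" P1] Suc.prems(1) by blast
    then show ?thesis unfolding P1_def by blast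
  qed
qed

lemma nbhd_path:
  assumes "\<Union>P \<noteq> {}" "\<forall>v\<in>\<Union>P. t < card (nbhd P v)" "j \<le> t"
  shows "\<exists>y. inj_on y {..j} \<and> (\<forall>i\<le>j. y i \<in> \<Union>P) \<and> (\<forall>i<j. \<exists>S\<in>P. y i \<in> S \<and> y (Suc i) \<in> S)"
  using assms(3)
proof (induction j)
  case 0
  obtain v where "v \<in> \<Union>P" using assms(1) by blast
  then show ?case by (intro exI[of _ "\<lambda>_. v"]) auto
next
  case (Suc j)
  then obtain y where y: "inj_on y {..j}" "\<forall>i\<le>j. y i \<in> \<Union>P" "\<forall>i<j. \<exists>S\<in>P. y i \<in> S \<and> y (Suc i) \<in> S"
    by auto
  \<comment> \<open>Avoiding the vertices before \<open>y j\<close> is enough, since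
    \<open>nbhd\<close> already excludes \<open>y j\<close> itself.\<close>
  have "card (y ` {..<j}) < card (nbhd P (y j))"
    using card_image_le[of "{..<j}" y] assms(2) y(2) Suc.prems by (metis Suc_leD card_lessThan finite_lessThan le_less_trans order_refl)
  then have "\<not> nbhd P (y j) \<subseteq> y ` {..<j}"
    by (meson card_mono finite_imageI finite_lessThan leD)
  then obtain z where z: "z \<in> nbhd P (y j)" "z \<notin> y ` {..<j}" by blast
  then have zj: "z \<noteq> y j" "\<exists>S\<in>P. y j \<in> S \<and> z \<in> S" by (auto simp: nbhd_def)
  define y' where "y' = y(Suc j := z)"
  have "{..Suc j} = insert (Suc j) {..j}" "{..j} = insert j {..<j}" by auto
  then have "inj_on y' {..Suc j}"
    using y(1) z zj unfolding y'_def by (auto simp: inj_on_def)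
  moreover have "\<forall>i\<le>Suc j. y' i \<in> \<Union>P"
    using y(2) zj unfolding y'_def by (auto simp: le_Suc_eq)
  moreover have "\<forall>i<Suc j. \<exists>S\<in>P. y' i \<in> S \<and> y' (Suc i) \<in> S"
    using y(3) zj unfolding y'_def by (auto simp: less_Suc_eq)
  ultimately show ?case by blast
qed

text \<open>At each step fewer than \<open>t\<close> earlier choices and \<open>c\<close> are
  excluded. The value \<open>c\<close> is kept free for the centre that closes the cycle.\<close>

lemma greedy_representatives:
  fixes D :: "nat \<Rightarrow> 'a set"
  assumes "\<And>i. i < t \<Longrightarrow> t < card (D i)" "j \<le> t"
  shows "\<exists>d. inj_on d {..<j} \<and> (\<forall>i<j. d i \<in> D i - {c})"
  using assms(2)
proof (induction j)
  case 0
  show ?case by auto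
next
  case (Suc j)
  then obtain d where d: "inj_on d {..<j}" "\<forall>i<j. d i \<in> D i - {c}" by auto
  have "card (insert c (d ` {..<j})) \<le> Suc j"
    using card_image_le[of "{..<j}" d] by (intro card_insert_le_m1) auto
  also have "\<dots> < card (D j)" using assms(1)[of j] Suc.prems by simp
  finally have "\<not> D j \<subseteq> insert c (d ` {..<j})"
    by (meson card_mono finite_imageI finite_insert finite_lessThan leD)
  then obtain z where "z \<in> D j - {c}" "z \<notin> d ` {..<j}" by blast
  then have "inj_on (d(j := z)) {..<Suc j} \<and> (\<forall>i<Suc j. (d(j := z)) i \<in> D i - {c})"
    using d by (auto simp: inj_on_def less_Suc_eq)
  then show ?case by blast
qed

text \<open>For odd \<open>l\<close>, the two edges through \<open>d 0\<close> are replaced by one edge containing \<open>{d 0, y 0, y 1}\<close>.\<close>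

lemma alternating_cycle:
  fixes y d :: "nat \<Rightarrow> 'a"
  assumes t: "1 \<le> t" and l: "l = 2 * t + 1 \<or> l = 2 * t + 2" and k: "2 \<le> k" and m: "l * (k + 3) \<le> m"
    and unif: "uniform_hypergraph k (V, H)"
    and y: "inj_on y {..t}" and d: "inj_on d {..t}" and yd: "y ` {..t} \<inter> d ` {..t} = {}"
    and ker: "\<And>i. i \<le> t \<Longrightarrow> robust_kernel m H {d i, y i}"
      "\<And>i. i < t \<Longrightarrow> robust_kernel m H {d i, y (Suc i)}"
      "robust_kernel m H {d t, y 0}" "robust_kernel m H {d 0, y 0, y 1}"
  shows "contains_copy (V, H) (linear_cycle k l)"
proof -
  \<comment> \<open>The cyclic sequence \<open>y 0, d 0, y 1, d 1, ..., y t, d t\<close> of length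
    \<open>2 * t + 2\<close>.\<close>
  define w where "w j = (if even j then y (j div 2) else d (j div 2))" for j
  have w_inj: "inj_on w {..<2 * t + 2}"
  proof (rule inj_onI)
    fix i j assume ij: "i \<in> {..<2 * t + 2}" "j \<in> {..<2 * t + 2}" "w i = w j"
    then have le: "i div 2 \<le> t" "j div 2 \<le> t" by auto
    have "even i = even j"
      using ij(3) yd le unfolding w_def by (auto split: if_splits)
    moreover have "i div 2 = j div 2"
      using ij(3) le y d \<open>even i = even j\<close> unfolding w_def by (auto dest: inj_onD split: if_splits)
    ultimately show "i = j" by (metis even_two_times_div_two odd_two_times_div_two_succ)
  qed
  have w_ker: "robust_kernel m H {w j, w (Suc j)}" if "Suc j < 2 * t + 2" for j
  proof (cases "even j")
    case True
    then show ?thesis using ker(1)[of "j div 2"] that by (simp add: w_def insert_commute)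
  next
    case False
    then obtain i where "j = 2 * i + 1" by (elim oddE)
    then show ?thesis using ker(2)[of i] that by (simp add: w_def)
  qed
  have w_last: "robust_kernel m H {w (2 * t + 1), w 0}" using ker(3) by (simp add: w_def)
  have l3: "3 \<le> l" using t l by auto
  have c2: "card {a, b} \<le> 3" "card {a, b, c} \<le> 3" for a b c :: 'a
    by (auto simp: card_insert_if)
  show ?thesis
  proof (cases "l = 2 * t + 2")
    case True
    show ?thesis
    proof (rule contains_linear_cycle[OF l3 k unif, where v = w and A = "\<lambda>i. {w i, w (Suc i mod l)}"])
      show "robust_kernel m H {w i, w (Suc i mod l)}" if "i < l" for i
        using w_ker[of i] w_last that True by (cases "Suc i = l") auto
    qed (use w_inj True m c2 in auto)
  next
    case False
    then have l: "l = 2 * t + 1" using l by simp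
    \<comment> \<open>Skipping \<open>w 1 = d 0\<close> shortens the cycle by one; this vertex
      becomes the third vertex of the kernel \<open>A 0\<close>.\<close>
    define v where "v j = (if j = 0 then w 0 else w (Suc j))" for j
    define A where "A j = (if j = 0 then {w 0, w 1, w 2} else {v j, v (Suc j mod l)})" for j
    have ww: "w i = w j \<longleftrightarrow> i = j" if "i < 2 * t + 2" "j < 2 * t + 2" for i j
      using w_inj that by (auto dest: inj_onD)
    show ?thesis
    proof (rule contains_linear_cycle[OF l3 k unif, where v = v and A = A])
      show "inj_on v {..<l}"
        unfolding inj_on_def v_def l using ww by auto
      show "finite (A i) \<and> card (A i) \<le> 3" for i
        unfolding A_def using c2 by auto
      show "v i \<in> A i \<and> v (Suc i mod l) \<in> A i" if "i < l" for i
        unfolding A_def v_def using l3 by (auto simp: numeral_2_eq_2)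
      show "robust_kernel m H (A i)" if "i < l" for i
      proof (cases "i = 0")
        case True
        then show ?thesis using ker(4) by (simp add: A_def w_def insert_commute)
      next
        case False
        then show ?thesis
          using w_ker[of "Suc i"] w_last that l by (cases "Suc i = l") (auto simp: A_def v_def)
      qed
      show "A i \<inter> A j \<subseteq> {v i, v (Suc i mod l)}" if ij: "i < l" "j < l" "i \<noteq> j" for i j
      proof (cases "i = 0")
        case True
        have "Suc j mod l = (if Suc j = l then 0 else Suc j)" using ij by auto
        then have "w 1 \<notin> A j"
          using ww[of 1] ij True l t unfolding A_def v_def by auto
        then show ?thesis using True l3 by (auto simp: A_def v_def numeral_2_eq_2)
      next
        case False
        then show ?thesis by (auto simp: A_def)
      qed
    qed (use m in auto)
  qed
qed

text \<open>Averaging over all \<open>A \<subseteq> V\<close>: restricting centres to \<open>A\<close> and links to its complement keeps the two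
  kinds of vertices of the alternating cycle apart.\<close>

lemma ex_bipartition:
  fixes D :: "'a set \<Rightarrow> 'a set"
  assumes V: "finite V" and W: "finite W"
    and WD: "\<And>c S. (c, S) \<in> W \<Longrightarrow> S \<subseteq> V \<and> card S = s \<and> D S \<subseteq> V \<and> c \<in> D S \<and> D S \<inter> S = {} \<and> t < card (D S)"
  shows "\<exists>A\<subseteq>V. card W \<le> 2 ^ (s + Suc t) * card {(c, S)\<in>W. c \<in> A \<and> S \<inter> A = {} \<and> t < card (D S \<inter> A)}"
proof (rule ccontr)
  assume neg: "\<not> ?thesis"
  define R where "R A w \<longleftrightarrow> (case w of (c, S) \<Rightarrow> c \<in> A \<and> S \<inter> A = {} \<and> t < card (D S \<inter> A))" for A w
  have R_set: "{(c, S)\<in>W. c \<in> A \<and> S \<inter> A = {} \<and> t < card (D S \<inter> A)} = {w\<in>W. R A w}" for A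
    by (auto simp: R_def)
  have lt: "2 ^ (s + Suc t) * card {w\<in>W. R A w} < card W" if "A \<in> Pow V" for A
    using neg that unfolding R_set by (auto simp: not_le)
  \<comment> \<open>The pair is good for every \<open>A\<close> that contains \<open>Suc t\<close>
    chosen members of \<open>D S\<close>, among them \<open>c\<close>, and misses the
    \<open>s\<close> members of \<open>S\<close>. This prescribes \<open>A\<close> on
    \<open>s + Suc t\<close> vertices.\<close>
  have many: "2 ^ card V \<le> 2 ^ (s + Suc t) * card {A\<in>Pow V. R A w}" if "w \<in> W" for w
  proof -
    obtain c S where w: "w = (c, S)" by (cases w)
    have cS: "S \<subseteq> V" "card S = s" "D S \<subseteq> V" "c \<in> D S" "D S \<inter> S = {}" "t < card (D S)"
      using WD[of c S] that w by auto
    have fin: "finite (D S)" "finite S" using cS V finite_subset by auto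
    have "t \<le> card (D S - {c})" using cS fin by simp
    then obtain D0 where D0: "D0 \<subseteq> D S - {c}" "card D0 = t"
      by (meson obtain_subset_with_card_n)
    define D1 where "D1 = insert c D0"
    have "finite D0" "c \<notin> D0" using D0 finite_subset[of D0 "D S"] fin by auto
    then have D1: "D1 \<subseteq> D S" "card D1 = Suc t" "c \<in> D1" "finite D1"
      using D0 cS unfolding D1_def by auto
    have "inj_on (\<lambda>X. D1 \<union> X) (Pow (V - (D1 \<union> S)))"
      by (auto simp: inj_on_def)
    moreover have "(\<lambda>X. D1 \<union> X) ` Pow (V - (D1 \<union> S)) \<subseteq> {A\<in>Pow V. R A w}"
    proof (rule image_subsetI)
      fix X assume X: "X \<in> Pow (V - (D1 \<union> S))"
      have "card D1 \<le> card (D S \<inter> (D1 \<union> X))"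
        using D1 fin by (intro card_mono) auto
      then show "D1 \<union> X \<in> {A\<in>Pow V. R A w}"
        using X D1 cS unfolding R_def w by auto
    qed
    ultimately have "card (Pow (V - (D1 \<union> S))) \<le> card {A\<in>Pow V. R A w}"
      using V by (intro card_inj_on_le) auto
    then have le: "2 ^ card (V - (D1 \<union> S)) \<le> card {A\<in>Pow V. R A w}"
      using V by (simp add: card_Pow)
    have "card (D1 \<union> S) = Suc t + s"
      using D1 cS fin by (subst card_Un_disjoint) auto
    moreover have sub: "D1 \<union> S \<subseteq> V" using D1 cS by blast
    ultimately have "card (V - (D1 \<union> S)) + (s + Suc t) = card V"
      using card_Diff_subset[OF finite_subset[OF sub V] sub] card_mono[OF V sub] by simp
    then have "2 ^ card V = 2 ^ (s + Suc t) * (2::nat) ^ card (V - (D1 \<union> S))"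
      by (metis add.commute power_add)
    with le show ?thesis by simp
  qed
  have "(\<Sum>A\<in>Pow V. card {w\<in>W. R A w}) = (\<Sum>w\<in>W. card {A\<in>Pow V. R A w})"
    using V W by (intro sum_multicount_gen) auto
  then have "(\<Sum>A\<in>Pow V. 2 ^ (s + Suc t) * card {w\<in>W. R A w}) = (\<Sum>w\<in>W. 2 ^ (s + Suc t) * card {A\<in>Pow V. R A w})"
    by (simp flip: sum_distrib_left)
  also have "\<dots> \<ge> (\<Sum>w\<in>W. 2 ^ card V)"
    using many by (rule sum_mono)
  finally have "card W * 2 ^ card V \<le> (\<Sum>A\<in>Pow V. 2 ^ (s + Suc t) * card {w\<in>W. R A w})"
    by simp
  also have "\<dots> < (\<Sum>A\<in>Pow V. card W)"
    using lt V by (intro sum_strict_mono) auto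
  finally show False using V by (simp add: card_Pow)
qed

text \<open>A centered edge is a \<open>(k - 1)\<close>-set \<open>S\<close> with a centre from
  \<open>D S\<close>. Sets with at most \<open>t\<close> centres give the main term. If the others
  had too many pairs, some centre \<open>c\<close> would have a large link, and a path there
  together with further centres gives the cycle.\<close>

lemma card_centered_le:
  assumes t: "1 \<le> t" and l: "l = 2 * t + 1 \<or> l = 2 * t + 2" and k: "2 \<le> k" and m: "l * (k + 3) \<le> m"
    and unif: "uniform_hypergraph k (V, H)" and V: "finite V"
    and free: "\<not> contains_copy (V, H) (linear_cycle k l)"
  shows "card {F. F \<subseteq> V \<and> card F = k \<and> centered m H F} \<le>
    t * (card V choose (k - 1)) + 2 ^ (k + 2 * t) * card V ^ 2"
proof -
  define \<S> where "\<S> = {S. S \<subseteq> V \<and> card S = k - 1}"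
  define D where "D S = {x\<in>V - S. \<forall>y\<in>S. \<forall>y'\<in>S. robust_kernel m H {x, y, y'}}" for S
  define W where "W = (SIGMA S:{S\<in>\<S>. t < card (D S)}. D S)"
  \<comment> \<open>Centres come first in \<open>W'\<close>, so that its pairs can be summed by
    centre, whereas \<open>W\<close> sums them by \<open>S\<close>.\<close>
  define W' where "W' = prod.swap ` W"
  have fS: "finite \<S>" unfolding \<S>_def using V by simp
  have fD: "finite (D S)" for S unfolding D_def using V by simp
  have fW: "finite W" unfolding W_def using fS fD by (intro finite_SigmaI) auto
  have W': "(c, S) \<in> W' \<longleftrightarrow> S \<in> \<S> \<and> t < card (D S) \<and> c \<in> D S" for c S
    unfolding W'_def W_def by (auto simp: image_iff)
  have cW: "card W' = card W" unfolding W'_def by (rule card_image) simp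
  have "{F. F \<subseteq> V \<and> card F = k \<and> centered m H F} \<subseteq> (\<Union>S\<in>\<S>. (\<lambda>x. insert x S) ` D S)"
  proof
    fix F assume F: "F \<in> {F. F \<subseteq> V \<and> card F = k \<and> centered m H F}"
    then obtain x where x: "x \<in> F" "\<forall>y\<in>F - {x}. \<forall>y'\<in>F - {x}. robust_kernel m H {x, y, y'}"
      unfolding centered_def by blast
    then have "F - {x} \<in> \<S>" "x \<in> D (F - {x})" "F = insert x (F - {x})"
      using F unfolding \<S>_def D_def by auto
    then show "F \<in> (\<Union>S\<in>\<S>. (\<lambda>x. insert x S) ` D S)" by blast
  qed
  then have "card {F. F \<subseteq> V \<and> card F = k \<and> centered m H F} \<le> card (\<Union>S\<in>\<S>. (\<lambda>x. insert x S) ` D S)"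
    using fS fD by (intro card_mono) auto
  also have "\<dots> \<le> (\<Sum>S\<in>\<S>. card ((\<lambda>x. insert x S) ` D S))"
    by (rule card_UN_le[OF fS])
  also have "\<dots> \<le> (\<Sum>S\<in>\<S>. card (D S))"
    using fD by (intro sum_mono card_image_le)
  also have "\<dots> \<le> (\<Sum>S\<in>\<S>. t + (if t < card (D S) then card (D S) else 0))"
    by (intro sum_mono) auto
  also have "\<dots> = card \<S> * t + (\<Sum>S\<in>{S\<in>\<S>. t < card (D S)}. card (D S))"
    using fS by (simp add: sum.distrib sum.inter_filter)
  also have "card \<S> = card V choose (k - 1)"
    unfolding \<S>_def using n_subsets[OF V] .
  also have "(\<Sum>S\<in>{S\<in>\<S>. t < card (D S)}. card (D S)) = card W"
    unfolding W_def using fS fD by (simp add: card_SigmaI)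
  finally have le: "card {F. F \<subseteq> V \<and> card F = k \<and> centered m H F} \<le> t * (card V choose (k - 1)) + card W"
    by (simp add: mult.commute)
  have "card W \<le> 2 ^ (k + 2 * t) * card V ^ 2"
  proof (rule ccontr)
    assume big: "\<not> ?thesis"
    obtain A where A: "A \<subseteq> V" and WA: "card W' \<le> 2 ^ (k - 1 + Suc t) *
        card {(c, S)\<in>W'. c \<in> A \<and> S \<inter> A = {} \<and> t < card (D S \<inter> A)}"
    proof -
      have "finite W'" using fW unfolding W'_def by simp
      moreover have "S \<subseteq> V \<and> card S = k - 1 \<and> D S \<subseteq> V \<and> c \<in> D S \<and> D S \<inter> S = {} \<and> t < card (D S)"
        if "(c, S) \<in> W'" for c S
        using that unfolding W' \<S>_def D_def by auto
      ultimately show ?thesis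
        using ex_bipartition[OF V, of W' "k - 1" D t] that by blast
    qed
    define Z where "Z c = {S\<in>\<S>. c \<in> D S \<and> S \<inter> A = {} \<and> t < card (D S \<inter> A)}" for c
    have fZ: "finite (Z c)" for c unfolding Z_def using fS by simp
    have tc: "t < card (D S)" if "t < card (D S \<inter> A)" for S
      using that card_mono[OF fD, of "D S \<inter> A" S] by simp
    have "{(c, S)\<in>W'. c \<in> A \<and> S \<inter> A = {} \<and> t < card (D S \<inter> A)} = (SIGMA c:A. Z c)"
      unfolding W' Z_def using tc by auto
    then have WA': "card W \<le> 2 ^ (k + t) * (\<Sum>c\<in>A. card (Z c))"
      using WA cW k fZ finite_subset[OF A V] by (simp add: card_SigmaI)
    \<comment> \<open>Pigeonhole over the centres: the factor \<open>2 ^ (k + t)\<close> is lost to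
      the bipartition and \<open>2 ^ t * card V\<close> is the threshold of
      \<open>nbhd_core\<close>, which explains the constant \<open>2 ^ (k + 2 * t)\<close>.\<close>
    have "\<exists>c\<in>A. 2 ^ t * card V < card (Z c)"
    proof (rule ccontr)
      assume "\<not> ?thesis"
      then have "(\<Sum>c\<in>A. card (Z c)) \<le> (\<Sum>c\<in>A. 2 ^ t * card V)"
        by (intro sum_mono) (auto simp: not_less)
      also have "\<dots> = card A * (2 ^ t * card V)" by simp
      also have "\<dots> \<le> card V * (2 ^ t * card V)"
        using card_mono[OF V A] by (rule mult_right_mono) simp
      finally have "2 ^ (k + t) * (\<Sum>c\<in>A. card (Z c)) \<le> 2 ^ (k + t) * (card V * (2 ^ t * card V))"
        by (rule mult_left_mono) simp
      also have "\<dots> = 2 ^ (k + 2 * t) * card V ^ 2"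
        by (simp add: power_add power2_eq_square mult_2)
      finally show False using WA' big by linarith
    qed
    then obtain c where c: "c \<in> A" "2 ^ t * card V < card (Z c)" by blast
    have "Z c \<subseteq> Pow V" "{} \<notin> Z c"
      using k unfolding Z_def \<S>_def by auto
    then obtain P where P: "P \<subseteq> Z c" "\<Union>P \<noteq> {}" "\<forall>v\<in>\<Union>P. t < card (nbhd P v)"
      using nbhd_core[OF V _ _ c(2)] by blast
    obtain y where y: "inj_on y {..t}" "\<forall>i\<le>t. y i \<in> \<Union>P" "\<forall>i<t. \<exists>S\<in>P. y i \<in> S \<and> y (Suc i) \<in> S"
      using nbhd_path[OF P(2,3), of t] by blast
    obtain T where T: "\<And>i. i < t \<Longrightarrow> T i \<in> P \<and> y i \<in> T i \<and> y (Suc i) \<in> T i"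
      using y(3) by metis
    have "t < card (D (T i) \<inter> A)" if "i < t" for i
      using T[OF that] P(1) unfolding Z_def by auto
    then obtain d where d: "inj_on d {..<t}" "\<forall>i<t. d i \<in> D (T i) \<inter> A - {c}"
      using greedy_representatives[of t "\<lambda>i. D (T i) \<inter> A" t c] by blast
    \<comment> \<open>The last centre is \<open>c\<close>: it forms a robust kernel with each vertex
      of \<open>\<Union>P\<close>, so it can join the two ends of the path.\<close>
    define d' where "d' = d(t := c)"
    have cker: "robust_kernel m H {c, z}" if "z \<in> \<Union>P" for z
    proof -
      obtain S where "S \<in> P" "z \<in> S" using \<open>z \<in> \<Union>P\<close> by blast
      then have "c \<in> D S" using P(1) unfolding Z_def by auto
      then have "robust_kernel m H {c, z, z}" unfolding D_def using \<open>z \<in> S\<close> by blast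
      then show ?thesis by simp
    qed
    have dker: "robust_kernel m H {d i, z, z'}" if "i < t" "z \<in> T i" "z' \<in> T i" for i z z'
      using d(2) that unfolding D_def by blast
    have "contains_copy (V, H) (linear_cycle k l)"
    proof (rule alternating_cycle[OF t l k m unif y(1)])
      have eq: "{..t} = insert t {..<t}" by auto
      show "inj_on d' {..t}"
        unfolding d'_def eq using d by (auto simp: inj_on_def)
      have "d' ` {..t} \<subseteq> A" unfolding d'_def eq using d(2) c by auto
      moreover have "y ` {..t} \<inter> A = {}" using y(2) P(1) unfolding Z_def by auto
      ultimately show "y ` {..t} \<inter> d' ` {..t} = {}" by blast
      show "robust_kernel m H {d' i, y i}" if "i \<le> t" for i
        using cker[of "y i"] dker[of i "y i" "y i"] T[of i] y(2) that by (cases "i = t") (auto simp: d'_def)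
      show "robust_kernel m H {d' i, y (Suc i)}" if "i < t" for i
        using dker[of i "y (Suc i)" "y (Suc i)"] T[of i] that by (auto simp: d'_def)
      show "robust_kernel m H {d' t, y 0}"
        using cker y(2) by (simp add: d'_def)
      show "robust_kernel m H {d' 0, y 0, y 1}"
        using dker[of 0 "y 0" "y 1"] T[of 0] t by (auto simp: d'_def)
    qed
    then show False using free by simp
  qed
  then show ?thesis using le by linarith
qed

section \<open>Counting\<close>

lemma card_small_subsets_le:
  assumes "finite U"
  shows "card {R. R \<subseteq> U \<and> card R \<le> r} \<le> (card U + 1) ^ r"
proof -
  define \<F> where "\<F> = ({..<r} \<rightarrow>\<^sub>E insert None (Some ` U))"
  have fin: "finite \<F>" unfolding \<F>_def using assms by (intro finite_PiE) auto
  have "{R. R \<subseteq> U \<and> card R \<le> r} \<subseteq> (\<lambda>f. {u. Some u \<in> f ` {..<r}}) ` \<F>"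
  proof
    fix R assume R: "R \<in> {R. R \<subseteq> U \<and> card R \<le> r}"
    then have "finite R" using assms finite_subset by auto
    then obtain h where h: "bij_betw h {0..<card R} R" using ex_bij_betw_nat_finite by blast
    define f where "f = restrict (\<lambda>i. if i < card R then Some (h i) else None) {..<r}"
    have hR: "h ` {0..<card R} = R" using h by (simp add: bij_betw_def)
    have "f \<in> \<F>"
    proof -
      have "h i \<in> U" if "i < card R" for i
        using hR R that by (metis (mono_tags, lifting) atLeastLessThan_iff imageI mem_Collect_eq subsetD zero_le)
      then show ?thesis unfolding \<F>_def f_def by auto
    qed
    moreover have "R = {u. Some u \<in> f ` {..<r}}"
    proof (intro equalityI subsetI)
      fix u assume "u \<in> R"
      then obtain i where i: "i < card R" "u = h i" using hR by (metis atLeastLessThan_iff imageE)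
      then have "f i = Some u" "i < r" using R by (auto simp: f_def)
      then show "u \<in> {u. Some u \<in> f ` {..<r}}" by force
    next
      fix u assume "u \<in> {u. Some u \<in> f ` {..<r}}"
      then show "u \<in> R" using hR by (auto simp: f_def split: if_splits)
    qed
    ultimately show "R \<in> (\<lambda>f. {u. Some u \<in> f ` {..<r}}) ` \<F>" by blast
  qed
  then have "card {R. R \<subseteq> U \<and> card R \<le> r} \<le> card \<F>"
    using fin by (rule surj_card_le[rotated])
  also have "\<dots> = (card U + 1) ^ r"
    unfolding \<F>_def using assms by (simp add: card_funcsetE card_image)
  finally show ?thesis .
qed

text \<open>A cycle-free family is recovered from its robust kernels of size at most three, its
  edges that are not centered, and its centered edges as a subset of those that the kernels permit.
  The three factors count these data.\<close>

lemma forb_le: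
  assumes t: "1 \<le> t" and l: "l = 2 * t + 1 \<or> l = 2 * t + 2" and k: "5 \<le> k"
  shows "\<exists>N. \<forall>n b. n < 2 ^ b \<longrightarrow> 0 < b \<longrightarrow>
    forb k n (linear_cycle k l) \<le> 2 ^ (n ^ 3) * (n ^ k + 1) ^ (N * (2 * b) ^ (k * k) * n ^ (k - 2)) *
      2 ^ (t * (n choose (k - 1)) + 2 ^ (k + 2 * t) * n ^ 2)"
proof -
  define m where "m = l * (k + 3)"
  have l3: "3 \<le> l" using l t by auto
  obtain N where N: "\<And>n b H. n < 2 ^ b \<Longrightarrow> 0 < b \<Longrightarrow> uniform_hypergraph k ({1..n}, H) \<Longrightarrow>
    \<not> contains_copy ({1..n}, H) (linear_cycle k l) \<Longrightarrow>
    card {F\<in>H. \<not> centered m H F} \<le> N * (2 * b) ^ (k * k) * n ^ (k - 2)"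
    using few_noncentered[OF l3 k, of m] unfolding m_def by blast
  show ?thesis
  proof (intro exI[of _ N] allI impI)
    fix n b :: nat
    assume n: "n < 2 ^ b" and b: "0 < b"
    define V where "V = {1..n}"
    define \<Omega> where "\<Omega> = {F. F \<subseteq> V \<and> card F = k}"
    define r where "r = N * (2 * b) ^ (k * k) * n ^ (k - 2)"
    define M where "M = t * (n choose (k - 1)) + 2 ^ (k + 2 * t) * n ^ 2"
    \<comment> \<open>This is \<open>centered\<close> with the kernels read off from
      \<open>K\<close>, so that the possible centered edges depend on \<open>K\<close>
      alone.\<close>
    define cont where "cont K = {F\<in>\<Omega>. \<exists>x\<in>F. \<forall>y\<in>F - {x}. \<forall>y'\<in>F - {x}. (x, y, y') \<in> K}" for K
    define \<R> where "\<R> = {R. R \<subseteq> \<Omega> \<and> card R \<le> r}"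
    \<comment> \<open>The bound on \<open>cont K\<close> is part of the definition, so that it holds
      for every summand of the count below.\<close>
    define \<K> where "\<K> = {K. K \<subseteq> V \<times> V \<times> V \<and> card (cont K) \<le> M}"
    define \<H> where "\<H> = {E. uniform_hypergraph k (V, E) \<and> \<not> contains_copy (V, E) (linear_cycle k l)}"
    have V: "finite V" "card V = n" by (auto simp: V_def)
    have \<Omega>: "finite \<Omega>" "card \<Omega> \<le> n ^ k"
    proof -
      show "finite \<Omega>" unfolding \<Omega>_def using V by simp
      have "card \<Omega> = n choose k" unfolding \<Omega>_def using n_subsets[OF V(1)] V(2) by simp
      then show "card \<Omega> \<le> n ^ k"
        by (cases "k \<le> n") (auto simp: binomial_le_pow binomial_eq_0)
    qed
    have fin: "finite \<R>" "finite \<K>" "finite (cont K)" for K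
      unfolding \<R>_def \<K>_def cont_def using V \<Omega> by auto
    have "\<H> \<subseteq> (\<lambda>(K, R, C). R \<union> C) ` (SIGMA K:\<K>. \<R> \<times> Pow (cont K))"
    proof
      fix H assume "H \<in> \<H>"
      then have unif: "uniform_hypergraph k (V, H)" and free: "\<not> contains_copy (V, H) (linear_cycle k l)"
        by (auto simp: \<H>_def)
      have H\<Omega>: "H \<subseteq> \<Omega>" using unif by (auto simp: uniform_hypergraph_def \<Omega>_def)
      define K where "K = {(x, y, y') \<in> V \<times> V \<times> V. robust_kernel m H {x, y, y'}}"
      have cont_iff: "F \<in> cont K \<longleftrightarrow> F \<subseteq> V \<and> card F = k \<and> centered m H F" for F
        unfolding cont_def K_def \<Omega>_def centered_def by (auto 4 3)
      then have "cont K = {F. F \<subseteq> V \<and> card F = k \<and> centered m H F}" by blast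
      then have "card (cont K) \<le> M"
        using card_centered_le[OF t l _ _ unif V(1) free, of m] k V(2) unfolding M_def m_def by simp
      then have "K \<in> \<K>" unfolding \<K>_def K_def by auto
      moreover have "{F\<in>H. \<not> centered m H F} \<in> \<R>"
        unfolding \<R>_def r_def using N[OF n b] unif free H\<Omega> unfolding V_def by auto
      moreover have "{F\<in>H. centered m H F} \<in> Pow (cont K)"
        using H\<Omega> by (auto simp: cont_iff \<Omega>_def)
      moreover have "H = {F\<in>H. \<not> centered m H F} \<union> {F\<in>H. centered m H F}" by blast
      ultimately show "H \<in> (\<lambda>(K, R, C). R \<union> C) ` (SIGMA K:\<K>. \<R> \<times> Pow (cont K))"
        by (intro image_eqI[where x = "(K, {F\<in>H. \<not> centered m H F}, {F\<in>H. centered m H F})"]) auto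
    qed
    then have "card \<H> \<le> card (SIGMA K:\<K>. \<R> \<times> Pow (cont K))"
      using fin by (intro surj_card_le) auto
    also have "\<dots> = (\<Sum>K\<in>\<K>. card \<R> * 2 ^ card (cont K))"
      using fin by (subst card_SigmaI) (auto simp: card_cartesian_product card_Pow)
    also have "\<dots> \<le> (\<Sum>K\<in>\<K>. (n ^ k + 1) ^ r * 2 ^ M)"
    proof (intro sum_mono mult_mono)
      have "card \<R> \<le> (card \<Omega> + 1) ^ r"
        unfolding \<R>_def by (rule card_small_subsets_le[OF \<Omega>(1)])
      also have "\<dots> \<le> (n ^ k + 1) ^ r" using \<Omega>(2) by (intro power_mono) auto
      finally show "card \<R> \<le> (n ^ k + 1) ^ r" .
    qed (auto simp: \<K>_def)
    also have "\<dots> = card \<K> * ((n ^ k + 1) ^ r * 2 ^ M)" by simp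
    also have "card \<K> \<le> card (Pow (V \<times> V \<times> V))"
      unfolding \<K>_def using V by (intro card_mono) auto
    then have "card \<K> * ((n ^ k + 1) ^ r * 2 ^ M) \<le> 2 ^ (n ^ 3) * ((n ^ k + 1) ^ r * 2 ^ M)"
      using V by (intro mult_right_mono) (simp_all add: card_Pow card_cartesian_product power3_eq_cube mult.assoc)
    finally show "forb k n (linear_cycle k l) \<le> 2 ^ (n ^ 3) * (n ^ k + 1) ^ (N * (2 * b) ^ (k * k) * n ^ (k - 2)) *
      2 ^ (t * (n choose (k - 1)) + 2 ^ (k + 2 * t) * n ^ 2)"
      unfolding forb_def \<H>_def V_def r_def M_def by (simp add: mult.assoc)
  qed
qed

section \<open>The lower bound: families covered by \<open>t\<close> vertices\<close>

lemma linear_cycle_degree_le: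
  assumes l: "3 \<le> l"
  shows "card {i\<in>{..<l}. w \<in> enlarge_edge k {i, Suc i mod l}} \<le> 2"
proof (cases w)
  case (Inl a)
  \<comment> \<open>The vertex \<open>a\<close> is the first end of edge \<open>a\<close> and the
    second end of the cyclically preceding edge.\<close>
  have "{i\<in>{..<l}. w \<in> enlarge_edge k {i, Suc i mod l}} \<subseteq> {a, (if a = 0 then l - 1 else a - 1)}"
  proof
    fix i assume i: "i \<in> {i\<in>{..<l}. w \<in> enlarge_edge k {i, Suc i mod l}}"
    then have "a = i \<or> a = Suc i mod l" "i < l" by (auto simp: Inl enlarge_edge_def)
    moreover have "Suc i mod l = (if Suc i = l then 0 else Suc i)" using i by auto
    ultimately show "i \<in> {a, (if a = 0 then l - 1 else a - 1)}" by (auto split: if_splits)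
  qed
  then have "card {i\<in>{..<l}. w \<in> enlarge_edge k {i, Suc i mod l}} \<le> card {a, (if a = 0 then l - 1 else a - 1)}"
    by (rule card_mono[rotated]) simp
  also have "\<dots> \<le> 2" by (simp add: card_insert_if)
  finally show ?thesis .
next
  case (Inr p)
  have edge: "e = fst p" if "w \<in> enlarge_edge k e" for e
    using that by (auto simp: Inr enlarge_edge_def)
  have "i = j" if "i \<in> {i\<in>{..<l}. w \<in> enlarge_edge k {i, Suc i mod l}}"
    "j \<in> {i\<in>{..<l}. w \<in> enlarge_edge k {i, Suc i mod l}}" for i j
  proof -
    have "{i, Suc i mod l} = fst p" "{j, Suc j mod l} = fst p" "i < l" "j < l"
      using that edge by blast+
    then show ?thesis using cycle_edge_inj[OF l] by (simp add: inj_on_def)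
  qed
  then have "card {i\<in>{..<l}. w \<in> enlarge_edge k {i, Suc i mod l}} \<le> Suc 0"
    by (subst card_le_Suc0_iff_eq) auto
  then show ?thesis by simp
qed

text \<open>Each of the \<open>l\<close> edges of the copy meets \<open>L\<close>, while each vertex
  of \<open>L\<close> is in at most two of them.\<close>

lemma linear_cycle_cover:
  assumes l: "3 \<le> l" and L: "finite L" and cover: "\<And>F. F \<in> H \<Longrightarrow> F \<inter> L \<noteq> {}"
    and copy: "contains_copy (V, H) (linear_cycle k l)"
  shows "l \<le> 2 * card L"
proof -
  obtain f where f: "inj_on f (verts (linear_cycle k l))"
    "\<And>e. e \<in> edges (linear_cycle k l) \<Longrightarrow> f ` e \<in> H"
    using copy unfolding contains_copy_def by auto
  have ed: "enlarge_edge k {i, Suc i mod l} \<in> edges (linear_cycle k l)" if "i < l" for i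
    using that unfolding linear_cycle_def enlargement_def graph_cycle_def by auto
  have vt: "e \<subseteq> verts (linear_cycle k l)" if "e \<in> edges (linear_cycle k l)" for e
    using that l unfolding linear_cycle_def enlargement_def graph_cycle_def enlarge_edge_def
    by (fastforce intro: mod_less_divisor)
  define I where "I x = {i\<in>{..<l}. x \<in> f ` enlarge_edge k {i, Suc i mod l}}" for x
  have "card (I x) \<le> 2" for x
  proof (cases "\<exists>w\<in>verts (linear_cycle k l). f w = x")
    case True
    then obtain w where w: "w \<in> verts (linear_cycle k l)" "f w = x" by blast
    have "I x \<subseteq> {i\<in>{..<l}. w \<in> enlarge_edge k {i, Suc i mod l}}"
    proof
      fix i assume "i \<in> I x"
      then obtain w' where "i < l" "w' \<in> enlarge_edge k {i, Suc i mod l}" "f w' = f w"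
        using w by (auto simp: I_def)
      moreover from this have "w' = w"
        using f(1) w(1) vt[OF ed] by (meson inj_onD subsetD)
      ultimately show "i \<in> {i\<in>{..<l}. w \<in> enlarge_edge k {i, Suc i mod l}}" by simp
    qed
    then have "card (I x) \<le> card {i\<in>{..<l}. w \<in> enlarge_edge k {i, Suc i mod l}}"
      by (rule card_mono[rotated]) simp
    then show ?thesis using linear_cycle_degree_le[OF l, of w k] by linarith
  next
    case False
    then have "I x = {}" using vt[OF ed] by (fastforce simp: I_def)
    then show ?thesis by simp
  qed
  then have "(\<Sum>x\<in>L. card (I x)) \<le> (\<Sum>x\<in>L. 2)" by (intro sum_mono)
  moreover have "{..<l} \<subseteq> (\<Union>x\<in>L. I x)"
    using f(2)[OF ed] cover by (fastforce simp: I_def)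
  then have "card {..<l} \<le> card (\<Union>x\<in>L. I x)"
    using L by (intro card_mono) (auto simp: I_def)
  moreover have "card (\<Union>x\<in>L. I x) \<le> (\<Sum>x\<in>L. card (I x))"
    by (rule card_UN_le[OF L])
  ultimately show ?thesis by simp
qed

text \<open>All subfamilies of \<open>\<E>\<close> are covered by the \<open>t\<close> vertices
  \<open>{1..t}\<close>, too few for a cycle of length \<open>l > 2 * t\<close>.\<close>

lemma forb_ge:
  assumes l: "3 \<le> l" "2 * t < l" and k: "1 \<le> k" and tn: "t \<le> n"
  shows "2 ^ (t * ((n - t) choose (k - 1))) \<le> forb k n (linear_cycle k l)"
proof -
  define \<S> where "\<S> = {S. S \<subseteq> {t<..n} \<and> card S = k - 1}"
  define \<E> where "\<E> = (\<lambda>(x, S). insert x S) ` ({1..t} \<times> \<S>)"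
  have fS: "finite \<S>" unfolding \<S>_def by simp
  have out: "x \<notin> S" if "x \<in> {1..t}" "S \<in> \<S>" for x S using that by (auto simp: \<S>_def)
  have "inj_on (\<lambda>(x, S). insert x S) ({1..t} \<times> \<S>)"
  proof (rule inj_onI, clarify)
    fix x S y T assume *: "x \<in> {1..t}" "S \<in> \<S>" "y \<in> {1..t}" "T \<in> \<S>" "insert x S = insert y T"
    have "insert x S \<inter> {1..t} = {x}" "insert y T \<inter> {1..t} = {y}"
      using * by (auto simp: \<S>_def)
    then have "x = y" using *(5) by auto
    then show "x = y \<and> S = T" using * out by (metis insert_ident)
  qed
  then have cE: "card \<E> = t * ((n - t) choose (k - 1))"
    unfolding \<E>_def using n_subsets[of "{t<..n}" "k - 1"]
    by (simp add: card_image card_cartesian_product \<S>_def)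
  have "E \<in> {E. uniform_hypergraph k ({1..n}, E) \<and> \<not> contains_copy ({1..n}, E) (linear_cycle k l)}"
    if E: "E \<subseteq> \<E>" for E
  proof -
    have EE: "\<exists>x S. F = insert x S \<and> x \<in> {1..t} \<and> S \<in> \<S>" if "F \<in> E" for F
    proof -
      have "F \<in> \<E>" using that E by blast
      then show ?thesis unfolding \<E>_def by (elim imageE) (auto split: prod.splits)
    qed
    have "F \<subseteq> {1..n} \<and> finite F \<and> card F = k" if "F \<in> E" for F
    proof -
      obtain x S where xS: "F = insert x S" "x \<in> {1..t}" "S \<in> \<S>" using EE[OF \<open>F \<in> E\<close>] by blast
      then have "finite S" using finite_subset[of S "{t<..n}"] by (auto simp: \<S>_def)
      then show ?thesis using xS out[of x S] k tn by (auto simp: \<S>_def)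
    qed
    then have "uniform_hypergraph k ({1..n}, E)" by (simp add: uniform_hypergraph_def)
    moreover have "F \<inter> {1..t} \<noteq> {}" if "F \<in> E" for F using EE[OF that] by auto
    then have "\<not> contains_copy ({1..n}, E) (linear_cycle k l)"
      using linear_cycle_cover[OF l(1), of "{1..t}" E "{1..n}" k] l(2) by auto
    ultimately show ?thesis by simp
  qed
  moreover have "finite {E. uniform_hypergraph k ({1..n}, E) \<and> \<not> contains_copy ({1..n}, E) (linear_cycle k l)}"
    by (rule finite_subset[of _ "Pow (Pow {1..n})"]) (auto simp: uniform_hypergraph_def)
  ultimately have "card (Pow \<E>) \<le> forb k n (linear_cycle k l)"
    unfolding forb_def by (intro card_mono) auto
  moreover have "finite \<E>" unfolding \<E>_def using fS by auto
  ultimately show ?thesis using cE by (simp add: card_Pow)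
qed

section \<open>Asymptotics\<close>

text \<open>Up to a constant, this is the contribution of the edges that are not centered, relative
  to \<open>n ^ (k - 1)\<close>.\<close>

lemma log_power_over_id: "((\<lambda>n::nat. (log 2 (real n) + 1) ^ K * log 2 (real n) / real n) \<longlongrightarrow> 0) at_top"
  by real_asymp

text \<open>Lowering the upper index \<open>n - t\<close> by one multiplies the binomial coefficient
  by \<open>1 - r / (n - t)\<close>, which tends to 1.\<close>

lemma binomial_shift_ratio:
  "(\<lambda>n. real ((n - t) choose r) / real (n choose r)) \<longlonglongrightarrow> 1"
proof (induction t)
  case 0
  have "eventually (\<lambda>n. real ((n - 0) choose r) / real (n choose r) = 1) sequentially"
    using eventually_ge_at_top[of r] by eventually_elim (simp add: binomial_eq_0_iff)
  then show ?case by (rule tendsto_eventually)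
next
  case (Suc t)
  have "(\<lambda>n. 1 - real r / real (n - t)) \<longlonglongrightarrow> 1"
    by real_asymp
  moreover have "\<forall>\<^sub>F n in sequentially. 1 - real r / real (n - t) = real ((n - Suc t) choose r) / real ((n - t) choose r)"
    using eventually_ge_at_top[of "r + t + 1"]
  proof eventually_elim
    case (elim n)
    have "(n - t - r) * ((n - t) choose r) = (n - t) * ((n - t - 1) choose r)"
      using binomial_absorb_comp[of "n - t" r] by simp
    then have "real (n - t - r) * real ((n - t) choose r) = real (n - t) * real ((n - Suc t) choose r)"
      by (metis Suc_eq_plus1 diff_diff_left of_nat_mult)
    moreover have "real ((n - t) choose r) > 0" using elim by simp
    ultimately show ?case
      using elim by (simp add: field_simps of_nat_diff)
  qed
  ultimately have "(\<lambda>n. real ((n - Suc t) choose r) / real ((n - t) choose r)) \<longlonglongrightarrow> 1"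
    using Lim_transform_eventually by fast
  from tendsto_mult[OF this Suc.IH]
  have "(\<lambda>n. real ((n - Suc t) choose r) / real ((n - t) choose r) * (real ((n - t) choose r) / real (n choose r))) \<longlonglongrightarrow> 1"
    by simp
  moreover have "\<forall>\<^sub>F n in sequentially. real ((n - Suc t) choose r) / real ((n - t) choose r) * (real ((n - t) choose r) / real (n choose r))
      = real ((n - Suc t) choose r) / real (n choose r)"
    using eventually_ge_at_top[of "r + t + 1"] by eventually_elim (simp add: binomial_eq_0_iff)
  ultimately show ?case
    using Lim_transform_eventually by fast
qed

lemma log2_of_nat_mono: "0 < a \<Longrightarrow> a \<le> b \<Longrightarrow> log 2 (real a) \<le> log 2 (real b)"
  by simp

lemma log_upper_bound:
  fixes k t N c n :: nat
  assumes k: "5 \<le> k" and n: "2 \<le> n" "k \<le> n"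
    and upper: "\<And>b. n < 2 ^ b \<Longrightarrow> 0 < b \<Longrightarrow> f \<le> 2 ^ (n ^ 3) *
      (n ^ k + 1) ^ (N * (2 * b) ^ (k * k) * n ^ (k - 2)) * 2 ^ (t * (n choose (k - 1)) + c * n ^ 2)"
    and f: "0 < (f :: nat)"
  shows "log 2 (real f) \<le> real t * real (n choose (k - 1)) + real (n choose (k - 1)) * (real (k - 1) ^ (k - 1) *
    ((1 + real c) / real n + real N * 2 ^ (k * k) * (real k + 1) * ((log 2 n + 1) ^ (k * k) * log 2 n / n)))"
proof -
  \<comment> \<open>The number of binary digits of \<open>n\<close>.\<close>
  define b where "b = nat \<lfloor>log 2 n\<rfloor> + 1"
  define s where "s = log 2 (real n)"
  have s1: "1 \<le> s" unfolding s_def using n by (simp add: le_log_iff)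
  have b0: "0 < b" by (simp add: b_def)
  have bs: "real b \<le> s + 1" unfolding b_def s_def[symmetric] using s1 by (simp add: of_nat_nat)
  have sb: "s < real b" unfolding b_def s_def[symmetric] using s1 by (simp add: of_nat_nat) linarith
  then have "2 powr s < 2 powr real b" by simp
  then have nb: "n < 2 ^ b"
    unfolding s_def using n by (simp add: powr_realpow)
  define r where "r = N * (2 * b) ^ (k * k) * n ^ (k - 2)"
  define C where "C = real (n choose (k - 1))"
  \<comment> \<open>The bound \<open>G \<le> C\<close> turns an error relative to
    \<open>n ^ (k - 1)\<close> into one relative to the binomial coefficient.\<close>
  define G where "G = n ^ (k - 1) / real (k - 1) ^ (k - 1)"
  have GC: "G \<le> C"
    unfolding G_def C_def using binomial_ge_n_over_k_pow_k[of "k - 1" n, where 'a = real] n by (simp add: power_divide)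
  have "log 2 f \<le> log 2 (real (2 ^ (n ^ 3) * (n ^ k + 1) ^ r * 2 ^ (t * (n choose (k - 1)) + c * n ^ 2)))"
    using upper[OF nb b0] f unfolding r_def by (intro log2_of_nat_mono)
  also have "\<dots> = real n ^ 3 + r * log 2 (real (n ^ k + 1)) + (t * (n choose (k - 1)) + c * n ^ 2)"
  proof -
    have "0 < 1 + real n ^ k" by (simp add: add_pos_nonneg)
    then show ?thesis by (simp add: log_mult log_nat_power)
  qed
  also have "log 2 (real (n ^ k + 1)) \<le> log 2 (real (n ^ (k + 1)))"
  proof -
    have "1 \<le> n ^ k" using n by simp
    then have "n ^ k + 1 \<le> n ^ k * 2" by linarith
    also have "\<dots> \<le> n ^ k * n" using n by (intro mult_left_mono) auto
    finally show ?thesis by (intro log2_of_nat_mono) (simp_all add: mult.commute)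
  qed
  also have "log 2 (real (n ^ (k + 1))) = (k + 1) * s"
    using n unfolding s_def of_nat_power by (intro log_nat_power) simp
  finally have le: "log 2 f \<le> n ^ 3 + r * ((k + 1) * s) + (t * (n choose (k - 1)) + c * n ^ 2)"
    by (simp add: mult_left_mono)
  have "real r \<le> N * (2 * (s + 1)) ^ (k * k) * n ^ (k - 2)"
  proof -
    have "(2 * real b) ^ (k * k) \<le> (2 * (s + 1)) ^ (k * k)"
      using bs by (intro power_mono) auto
    then have "N * (2 * real b) ^ (k * k) * real n ^ (k - 2) \<le> N * (2 * (s + 1)) ^ (k * k) * real n ^ (k - 2)"
      by (intro mult_right_mono mult_left_mono) auto
    then show ?thesis unfolding r_def by simp
  qed
  then have "r * ((k + 1) * s) \<le> N * (2 * (s + 1)) ^ (k * k) * n ^ (k - 2) * ((k + 1) * s)"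
    using s1 by (intro mult_right_mono) auto
  also have "\<dots> = n ^ (k - 1) * (real N * 2 ^ (k * k) * (real k + 1) * ((s + 1) ^ (k * k) * s / n))"
  proof -
    have e: "k - 1 = Suc (k - 2)" using k by simp
    show ?thesis unfolding e power_mult_distrib[of 2 "s + 1"] using n by (simp add: algebra_simps)
  qed
  finally have 1: "r * ((k + 1) * s) \<le> n ^ (k - 1) * (real N * 2 ^ (k * k) * (real k + 1) * ((s + 1) ^ (k * k) * s / n))" .
  have "real n ^ 3 + c * n ^ 2 \<le> real n ^ 3 * (1 + c)"
    using n by (simp add: algebra_simps power_increasing mult_left_mono)
  also have "\<dots> = real n ^ 4 / n * (1 + c)" using n by (simp add: power_eq_if)
  \<comment> \<open>From \<open>k \<ge> 5\<close> one gets \<open>4 \<le> k - 1\<close>, so the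
    \<open>n ^ 3\<close> bits for the kernels are of lower order.\<close>
  also have "\<dots> \<le> real n ^ (k - 1) / n * (1 + c)"
    using n k by (intro mult_right_mono divide_right_mono power_increasing) auto
  finally have 2: "real n ^ 3 + c * n ^ 2 \<le> real n ^ (k - 1) * ((1 + c) / n)" by simp
  define x where "x = (1 + real c) / real n + real N * 2 ^ (k * k) * (real k + 1) * ((s + 1) ^ (k * k) * s / n)"
  have x0: "0 \<le> x" unfolding x_def using s1 by simp
  have "log 2 f \<le> t * (n choose (k - 1)) + real n ^ (k - 1) * x"
    using le 1 2 unfolding x_def by (simp add: algebra_simps)
  also have "real n ^ (k - 1) * x = G * (real (k - 1) ^ (k - 1) * x)"
    unfolding G_def using k by simp
  also have "\<dots> \<le> C * (real (k - 1) ^ (k - 1) * x)"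
    using GC x0 by (intro mult_right_mono) auto
  finally show ?thesis unfolding x_def C_def s_def by simp
qed

text \<open>Divided by \<open>t * (n choose (k - 1))\<close>, both bounds on
  \<open>log 2 (f n)\<close> tend to 1.\<close>

lemma exponent_asymptotics:
  fixes f :: "nat \<Rightarrow> nat" and k t N c :: nat
  assumes k: "5 \<le> k" and t: "1 \<le> t"
    and lower: "\<And>n. t \<le> n \<Longrightarrow> 2 ^ (t * ((n - t) choose (k - 1))) \<le> f n"
    and upper: "\<And>n b. n < 2 ^ b \<Longrightarrow> 0 < b \<Longrightarrow> f n \<le> 2 ^ (n ^ 3) *
      (n ^ k + 1) ^ (N * (2 * b) ^ (k * k) * n ^ (k - 2)) * 2 ^ (t * (n choose (k - 1)) + c * n ^ 2)"
  shows "\<exists>\<epsilon> :: nat \<Rightarrow> real. \<epsilon> \<in> o(\<lambda>_. 1) \<and>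
    (\<forall>\<^sub>F n in sequentially. real (f n) = 2 powr ((1 + \<epsilon> n) * real t * real (n choose (k - 1))))"
proof -
  define C where "C n = real (n choose (k - 1))" for n
  \<comment> \<open>Solving the desired identity for \<open>\<epsilon>\<close> leaves only its
    convergence to be shown.\<close>
  define \<epsilon> where "\<epsilon> n = log 2 (f n) / (t * C n) - 1" for n
  define g where "g n = real (k - 1) ^ (k - 1) *
    ((1 + real c) / real n + real N * 2 ^ (k * k) * (real k + 1) * ((log 2 n + 1) ^ (k * k) * log 2 n / n))" for n :: nat
  have fpos: "0 < f n" if "t \<le> n" for n
    using lower[OF that] by (rule less_le_trans[rotated]) simp
  have Cpos: "0 < C n" if "k \<le> n" for n
    using that by (simp add: C_def)
  have "g \<longlonglongrightarrow> real (k - 1) ^ (k - 1) * (0 + real N * 2 ^ (k * k) * (real k + 1) * 0)"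
    unfolding g_def by (intro tendsto_intros log_power_over_id)
  then have g0: "g \<longlonglongrightarrow> 0" by simp
  have ev: "\<forall>\<^sub>F n in sequentially. t \<le> n \<and> k \<le> n \<and> 2 \<le> n"
    using eventually_ge_at_top[of "max t (max k 2)"] by eventually_elim auto
  have "\<epsilon> \<longlonglongrightarrow> 0"
  proof (rule tendsto_sandwich[OF _ _ _ g0])
    show "(\<lambda>n. real ((n - t) choose (k - 1)) / real (n choose (k - 1)) - 1) \<longlonglongrightarrow> 0"
      using tendsto_diff[OF binomial_shift_ratio[of t "k - 1"] tendsto_const[of 1]] by simp
    show "\<forall>\<^sub>F n in sequentially. real ((n - t) choose (k - 1)) / real (n choose (k - 1)) - 1 \<le> \<epsilon> n"
      using ev
    proof eventually_elim
      case (elim n)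
      have "real (t * ((n - t) choose (k - 1))) = log 2 (real (2 ^ (t * ((n - t) choose (k - 1)))))"
        by simp
      also have "\<dots> \<le> log 2 (f n)"
        using lower[of n] elim by (intro log2_of_nat_mono) auto
      finally have "t * real ((n - t) choose (k - 1)) / (t * C n) \<le> log 2 (f n) / (t * C n)"
        using Cpos[of n] elim by (intro divide_right_mono) auto
      then show ?case using t unfolding \<epsilon>_def C_def by simp
    qed
    show "\<forall>\<^sub>F n in sequentially. \<epsilon> n \<le> g n"
      using ev
    proof eventually_elim
      case (elim n)
      have "log 2 (f n) \<le> t * C n + C n * g n"
        unfolding C_def g_def using elim by (intro log_upper_bound[OF k] upper fpos) auto
      \<comment> \<open>As \<open>1 \<le> t\<close>, the error may be enlarged by the factor
        \<open>t\<close>; division by \<open>t * C n\<close> then leaves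
        \<open>1 + g n\<close>.\<close>
      also have "\<dots> \<le> t * C n + (t * C n) * g n"
      proof -
        have "0 \<le> g n" unfolding g_def using elim by simp
        then have "1 * (C n * g n) \<le> t * (C n * g n)"
          using t Cpos[of n] elim by (intro mult_right_mono) auto
        then show ?thesis by (simp add: mult.assoc)
      qed
      finally have "log 2 (f n) / (t * C n) \<le> (t * C n + (t * C n) * g n) / (t * C n)"
        using Cpos[of n] elim by (intro divide_right_mono) auto
      then show ?case
        using t Cpos[of n] elim unfolding \<epsilon>_def by (simp add: add_divide_distrib)
    qed
  qed
  then have "\<epsilon> \<in> o(\<lambda>_. 1)" by (intro smalloI_tendsto) auto
  moreover have "\<forall>\<^sub>F n in sequentially. real (f n) = 2 powr ((1 + \<epsilon> n) * real t * real (n choose (k - 1)))"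
    using ev
  proof eventually_elim
    case (elim n)
    have "(1 + \<epsilon> n) * real t * real (n choose (k - 1)) = log 2 (f n)"
      using t Cpos[of n] elim unfolding \<epsilon>_def C_def[symmetric] by simp
    then show ?case using fpos[of n] elim by simp
  qed
  ultimately show ?thesis by blast
qed

theorem theorem1p1:
  fixes k l :: nat
  assumes "k \<ge> 5" and "l \<ge> 3"
  shows "\<exists>\<epsilon> :: nat \<Rightarrow> real. \<epsilon> \<in> o(\<lambda>_. 1) \<and>
    (\<forall>\<^sub>F n in sequentially.
      real (forb k n (linear_cycle k l)) =
        2 powr ((1 + \<epsilon> n) * real_of_int \<lfloor>(real l - 1) / 2\<rfloor> * real (n choose (k - 1))))"
proof -
  define t where "t = (l - 1) div 2"
  have t: "1 \<le> t" and l: "l = 2 * t + 1 \<or> l = 2 * t + 2"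
    using assms(2) unfolding t_def by auto
  have "\<lfloor>(real l - 1) / 2\<rfloor> = int t"
    using l by (intro floor_unique) auto
  then have fl: "real_of_int \<lfloor>(real l - 1) / 2\<rfloor> = real t"
    by simp
  obtain N where "\<And>n b. n < 2 ^ b \<Longrightarrow> 0 < b \<Longrightarrow> forb k n (linear_cycle k l) \<le> 2 ^ (n ^ 3) *
      (n ^ k + 1) ^ (N * (2 * b) ^ (k * k) * n ^ (k - 2)) * 2 ^ (t * (n choose (k - 1)) + 2 ^ (k + 2 * t) * n ^ 2)"
    using forb_le[OF t l assms(1)] by blast
  moreover have "2 ^ (t * ((n - t) choose (k - 1))) \<le> forb k n (linear_cycle k l)" if "t \<le> n" for n
    using assms l that by (intro forb_ge) auto
  ultimately show ?thesis
    unfolding fl by (intro exponent_asymptotics[OF assms(1) t])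
qed

end
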